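(* If $T\in\mathcal{CPMM}$ is leo and recurrent, then $T$ is linearizable.
   Context: A continuous map on a closed interval is piecewise monotone if the interval splits into finitely many subintervals on each of which the map is monotone. A Markov partition for a continuous map $T:[0,1]\to[0,1]$ is a finite or countably infinite collection $\mathcal P$ of closed nondegenerate subintervals of $[0,1]$ such that: (1) distinct elements of $\mathcal P$ have disjoint interiors and $[0,1]\setminus\bigcup\mathcal P$ is at most countable; (2) $T|_i$ is monotone for each $i\in\mathcal P$ (classical), or piecewise monotone for each $i\in\mathcal P$ (slack); (3) for all $i,j\in\mathcal P$ and every maximal interval $i'\subset i$ of monotonicity of $T$, if $T(i')\cap j^\circ\ne\emptyset$ then $T(i')\supset j$. $\mathcal{CPMM}$ is the set of continuous maps $T:[0,1]\to[0,1]$ that are topologically mixing (for all nonempty open $U,V$ there is $n$ with $T^m(U)\cap V\neq\emptyset$ for all $m\ge n$), admit a countably infinite Markov partition, and have finite topological entropy $h_{top}(T)<\infty$. $T\in\mathcal{CPMM}$ is leo (locally eventually onto) if for every nonempty open set $U$ there is $n\in\mathbb N$ with $T^n(U)=[0,1]$. Transition matrix of $T$ with respect to $\mathcal P$: $M=(m_{ij})_{i,j\in\mathcal P}$, where $m_{ij}=0$ if $T(i)\not\supset j$, and otherwise $m_{ij}$ is the maximal number of intervals $i_1,\dots,i_\kappa\subset i$ with pairwise disjoint interiors such that each $T|_{i_\ell}$ is monotone and $T(i_\ell)\supset j$ (this number is finite). It is irreducible and aperiodic. For an irreducible nonnegative matrix $M$ with powers $M^n=(m_{ij}(n))$, let $R$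 be the common radius of convergence of the series $\sum_{n\ge0}m_{ij}(n)z^n$ (the Perron value is $\lambda_M=1/R<\infty$). Let $f_{ij}(1)=m_{ij}$, $f_{ij}(n+1)=\sum_{\alpha\ne j}m_{i\alpha}f_{\alpha j}(n)$ and $F_{ij}(z)=\sum_{n\ge1}f_{ij}(n)z^n$. $M$ is recurrent if $F_{ii}(R)=1$ and transient if $F_{ii}(R)<1$ (independently of $i$; recurrence is equivalent to $\sum_n m_{ij}(n)R^n=\infty$). $T$ is called recurrent if its transition matrix is recurrent; this does not depend on the choice of the Markov partition. A continuous interval map $S$ has constant slope $s$ if $|S'(x)|=s$ for all but countably many $x$. $T$ is linearizable if it is topologically conjugate to an interval map $[0,1]\to[0,1]$ of constant slope $e^{h_{top}(T)}$. *)

theory Defs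
  imports "HOL-Analysis.Analysis"
begin

text \<open>
  An interval map is a function on the reals of which only the values on \<open>{0..1}\<close> matter.
  ``Monotone'' is meant in the weak sense, increasing or decreasing.
\<close>

definition interval_map :: "(real \<Rightarrow> real) \<Rightarrow> bool" where
  "interval_map T \<longleftrightarrow> continuous_on {0..1} T \<and> T ` {0..1} \<subseteq> {0..1}"

definition monotone_map_on :: "real set \<Rightarrow> (real \<Rightarrow> real) \<Rightarrow> bool" where
  "monotone_map_on J T \<longleftrightarrow> mono_on J T \<or> antimono_on J T"

definition piecewise_monotone_on :: "real set \<Rightarrow> (real \<Rightarrow> real) \<Rightarrow> bool" where
  "piecewise_monotone_on J T \<longleftrightarrow> (\<exists>Q. Q division_of J \<and> (\<forall>K\<in>Q. monotone_map_on K T))"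

definition maximal_monotonicity_interval :: "(real \<Rightarrow> real) \<Rightarrow> real set \<Rightarrow> real set \<Rightarrow> bool" where
  "maximal_monotonicity_interval T i J \<longleftrightarrow>
     is_interval J \<and> J \<subseteq> i \<and> monotone_map_on J T \<and>
     (\<forall>K. is_interval K \<and> J \<subseteq> K \<and> K \<subseteq> i \<and> monotone_map_on K T \<longrightarrow> K = J)"

text \<open>
  Slack Markov partitions, finite or countably infinite. A monotone map is piecewise monotone, so
  the classical Markov partitions are among them.
\<close>

definition markov_partition :: "(real \<Rightarrow> real) \<Rightarrow> real set set \<Rightarrow> bool" where
  "markov_partition T P \<longleftrightarrow>
     countable P \<and>
     (\<forall>i\<in>P. \<exists>a b. 0 \<le> a \<and> a < b \<and> b \<le> 1 \<and> i = {a..b}) \<and>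
     pairwise (\<lambda>i j. interior i \<inter> interior j = {}) P \<and>
     countable ({0..1} - \<Union>P) \<and>
     (\<forall>i\<in>P. piecewise_monotone_on i T) \<and>
     (\<forall>i\<in>P. \<forall>j\<in>P. \<forall>J. maximal_monotonicity_interval T i J \<and> T ` J \<inter> interior j \<noteq> {}
        \<longrightarrow> j \<subseteq> T ` J)"

definition topologically_mixing :: "(real \<Rightarrow> real) \<Rightarrow> bool" where
  "topologically_mixing T \<longleftrightarrow>
     (\<forall>U V. openin (top_of_set {0..1}) U \<and> U \<noteq> {} \<and> openin (top_of_set {0..1}) V \<and> V \<noteq> {}
        \<longrightarrow> (\<exists>n. \<forall>m\<ge>n. (T ^^ m) ` U \<inter> V \<noteq> {}))"

definition leo :: "(real \<Rightarrow> real) \<Rightarrow> bool" where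
  "leo T \<longleftrightarrow>
     (\<forall>U. openin (top_of_set {0..1}) U \<and> U \<noteq> {} \<longrightarrow> (\<exists>n. (T ^^ n) ` U = {0..1}))"

text \<open>
  Topological entropy on \<open>{0..1}\<close> by Bowen's \<open>(n, \<epsilon>)\<close>-separated sets. The growth rate increases as
  \<open>\<epsilon>\<close> decreases, so the limit for \<open>\<epsilon>\<close> tending to 0 is the supremum. The logarithm of the maximal
  cardinality is taken as a supremum in the extended reals.
\<close>

definition separated_set :: "(real \<Rightarrow> real) \<Rightarrow> nat \<Rightarrow> real \<Rightarrow> real set \<Rightarrow> bool" where
  "separated_set T n \<epsilon> E \<longleftrightarrow>
     finite E \<and> E \<subseteq> {0..1} \<and>
     (\<forall>x\<in>E. \<forall>y\<in>E. x \<noteq> y \<longrightarrow> (\<exists>k<n. dist ((T ^^ k) x) ((T ^^ k) y) > \<epsilon>))"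

definition htop :: "(real \<Rightarrow> real) \<Rightarrow> ereal" where
  "htop T =
     (SUP \<epsilon>\<in>{0<..}. limsup (\<lambda>n. SUP E\<in>{E. separated_set T n \<epsilon> E \<and> E \<noteq> {}}.
        ereal (ln (real (card E)) / real n)))"

definition CPMM :: "(real \<Rightarrow> real) set" where
  "CPMM = {T. interval_map T \<and> topologically_mixing T \<and>
              (\<exists>P. markov_partition T P \<and> infinite P) \<and> htop T < \<infinity>}"

text \<open>
  The maximum exists: by uniform continuity the intervals \<open>K\<close> have a common positive lower bound
  on their lengths.
\<close>

definition transition_matrix :: "(real \<Rightarrow> real) \<Rightarrow> real set \<Rightarrow> real set \<Rightarrow> real" where
  "transition_matrix T i j =
     (if j \<subseteq> T ` i
      then real (Max {card Q | Q. finite Q \<and> pairwise (\<lambda>K L. interior K \<inter> interior L = {}) Q \<and>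
             (\<forall>K\<in>Q. is_interval K \<and> K \<subseteq> i \<and> monotone_map_on K T \<and> j \<subseteq> T ` K)})
      else 0)"

text \<open>
  Matrices indexed by a set \<open>I\<close>. For the transition matrix of a map with respect to a Markov
  partition, each column of each power has only finitely many nonzero entries (again by uniform
  continuity), so the infinite sums below are finite sums.
\<close>

primrec matrix_power :: "'a set \<Rightarrow> ('a \<Rightarrow> 'a \<Rightarrow> real) \<Rightarrow> nat \<Rightarrow> 'a \<Rightarrow> 'a \<Rightarrow> real" where
  "matrix_power I M 0 i j = (if i = j then 1 else 0)"
| "matrix_power I M (Suc n) i j = (\<Sum>\<^sub>\<infinity>\<alpha>\<in>I. M i \<alpha> * matrix_power I M n \<alpha> j)"

text \<open>The coefficients \<open>f\<^sub>i\<^sub>j(n)\<close>; the value at \<open>n = 0\<close> is not used.\<close>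

fun first_entrance :: "'a set \<Rightarrow> ('a \<Rightarrow> 'a \<Rightarrow> real) \<Rightarrow> nat \<Rightarrow> 'a \<Rightarrow> 'a \<Rightarrow> real" where
  "first_entrance I M 0 i j = 0"
| "first_entrance I M (Suc 0) i j = M i j"
| "first_entrance I M (Suc (Suc n)) i j =
     (\<Sum>\<^sub>\<infinity>\<alpha>\<in>I - {j}. M i \<alpha> * first_entrance I M (Suc n) \<alpha> j)"

text \<open>
  \<open>F\<^sub>i\<^sub>i(R) = 1\<close>, where \<open>R\<close> is the radius of convergence of \<open>\<Sum>n. m\<^sub>i\<^sub>j(n) z\<^sup>n\<close>. For an irreducible
  matrix it is the same for all \<open>i\<close> and \<open>j\<close>, so it is read off at the diagonal entry.
\<close>

definition recurrent_matrix :: "'a set \<Rightarrow> ('a \<Rightarrow> 'a \<Rightarrow> real) \<Rightarrow> bool" where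
  "recurrent_matrix I M \<longleftrightarrow>
     (\<forall>i\<in>I. \<exists>R. conv_radius (\<lambda>n. matrix_power I M n i i) = ereal R \<and>
        (\<lambda>n. first_entrance I M (Suc n) i i * R ^ Suc n) sums 1)"

text \<open>Recurrence does not depend on the choice of the Markov partition \<open>P\<close>.\<close>

definition recurrent_map :: "(real \<Rightarrow> real) \<Rightarrow> bool" where
  "recurrent_map T \<longleftrightarrow> (\<exists>P. markov_partition T P \<and> recurrent_matrix P (transition_matrix T))"

definition constant_slope :: "(real \<Rightarrow> real) \<Rightarrow> real \<Rightarrow> bool" where
  "constant_slope S s \<longleftrightarrow>
     countable {x\<in>{0..1}. \<not> (\<exists>D. (S has_real_derivative D) (at x within {0..1}) \<and> \<bar>D\<bar> = s)}"

definition topologically_conjugate :: "(real \<Rightarrow> real) \<Rightarrow> (real \<Rightarrow> real) \<Rightarrow> bool" where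
  "topologically_conjugate T S \<longleftrightarrow>
     (\<exists>\<psi> \<phi>. homeomorphism {0..1} {0..1} \<psi> \<phi> \<and> (\<forall>x\<in>{0..1}. \<psi> (T x) = S (\<psi> x)))"

definition linearizable :: "(real \<Rightarrow> real) \<Rightarrow> bool" where
  "linearizable T \<longleftrightarrow>
     (\<exists>S. interval_map S \<and> constant_slope S (exp (real_of_ereal (htop T))) \<and>
          topologically_conjugate T S)"

end

(*
  Recurrence makes the generating functions of the first entrances into a fixed cell, evaluated at
  the radius of convergence 1 / lam, a positive eigenvector of the transition matrix for the
  eigenvalue lam. As some iterate of T maps the cell onto [0,1], the entries of the eigenvector are
  summable, and lam > 1 because two disjoint subintervals of the cell are eventually mapped onto
  [0,1]. Weighting the cells by the normalized eigenvector and pulling point masses back along T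
  gives contents mu n that scale by lam under T up to a shift of n; a Banach limit nu of them
  satisfies nu (T ` A) = lam * nu A whenever T is injective on A. It has no atoms, since the cells
  carry all the mass and the mass near a point decreases by the factor lam at every step of its
  orbit, and it is positive on open sets since T is leo. Hence x |-> nu [0,x] conjugates T to a map
  of constant slope lam.

  It remains to see that lam = exp (htop T). The conjugate is Lipschitz with constant lam, which
  bounds the entropy from above. The n-th powers of the matrix count branches of the n-th iterate
  that map into a cell and cover it; half of them form a horseshoe, which bounds the entropy from
  below by the growth rate lam of these counts.
*)

theory Submission imports Defs begin

text \<open>With infinitely many cells there are two obstacles. A nonnegative eigenvector need not
  exist or be summable; here F(R) = 1 is what turns the inequality satisfied by the first-entrance
  sums into an equation. And mass may concentrate where cells accumulate. As the limit of the
  contents is only finitely additive, it could vanish on a point and still have mass bounded below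
  on all neighbourhoods of it. Continuity of the distribution function therefore rests on an
  estimate for the contents \<open>mu n\<close> that is uniform in \<open>n\<close>.

  Point masses make \<open>mu n\<close> a content on all sets, with an exact image formula wherever
  \<open>T\<close> is injective, and reduce everything to counting preimages. The sums are written
  as integrals of \<open>ennreal\<close> functions over counting measures, so that they can be
  rearranged before they are known to be finite.\<close>

section \<open>Shift-invariant limits of bounded sequences\<close>

text \<open>The n-th averages of all sequences together are one point \<open>p n\<close> of a
  product of compact intervals. By Tychonoff these points have a cluster point \<open>l\<close>, and
  along the filter \<open>F\<close> the averages converge to \<open>l\<close>. So linearity and
  order are limit rules, and shift invariance holds because a shift changes an average only by order
  1/n.\<close>

lemma banach_limit:
  obtains L :: "(nat \<Rightarrow> real) \<Rightarrow> real" where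
    "\<And>f g. Bseq f \<Longrightarrow> Bseq g \<Longrightarrow> L (\<lambda>n. f n + g n) = L f + L g"
    "\<And>c f. Bseq f \<Longrightarrow> L (\<lambda>n. c * f n) = c * L f"
    "\<And>f. Bseq f \<Longrightarrow> L (\<lambda>n. f (Suc n)) = L f"
    "\<And>f g N. Bseq f \<Longrightarrow> Bseq g \<Longrightarrow> (\<And>n. n \<ge> N \<Longrightarrow> f n \<le> g n) \<Longrightarrow> L f \<le> L g"
    "\<And>c. L (\<lambda>n. c) = c"
proof -
  define avg where "avg f n = (\<Sum>k<n. f k) / real n" for f :: "nat \<Rightarrow> real" and n
  define C where "C f = (SOME K. \<forall>n. \<bar>f n\<bar> \<le> K)" for f :: "nat \<Rightarrow> real"
  have C: "\<bar>f n\<bar> \<le> C f" if "Bseq f" for f n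
    using someI_ex[of "\<lambda>K. \<forall>n. \<bar>f n\<bar> \<le> K"] that unfolding C_def Bseq_def by (auto simp: real_norm_def)
  have C0: "0 \<le> C f" if "Bseq f" for f
    using C[OF that, of 0] by simp
  have avg_bound: "\<bar>avg f n\<bar> \<le> C f" if "Bseq f" for f n
  proof (cases "n = 0")
    case False
    have "\<bar>\<Sum>k<n. f k\<bar> \<le> (\<Sum>k<n. \<bar>f k\<bar>)" by (rule sum_abs)
    also have "\<dots> \<le> real n * C f"
      using sum_bounded_above[of "{..<n}" "\<lambda>k. \<bar>f k\<bar>" "C f"] C[OF that] by simp
    finally show ?thesis using False by (simp add: avg_def abs_div field_simps)
  qed (use C0[OF that] in \<open>simp add: avg_def\<close>)
  \<comment> \<open>Unbounded sequences get the factor {0}, so that the product over all sequences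
    is compact.\<close>
  define Q where "Q f = (if Bseq f then {- C f..C f} else {0})" for f
  define p where "p n f = (if Bseq f then avg f n else 0)" for n f
  have "compact (Pi\<^sub>E UNIV Q)"
  proof -
    have "compactin (product_topology (\<lambda>i. euclidean) UNIV) (Pi\<^sub>E UNIV Q)"
      unfolding compactin_PiE by (auto simp: Q_def)
    then show ?thesis by (simp add: euclidean_product_topology)
  qed
  moreover have "p n \<in> Pi\<^sub>E UNIV Q" for n
    using avg_bound by (auto simp: p_def Q_def abs_le_iff minus_le_iff)
  ultimately obtain l where l: "inf (nhds l) (filtermap p sequentially) \<noteq> bot"
    unfolding compact_filter
    by (metis (no_types, lifting) eventually_filtermap eventually_sequentially filtermap_bot_iff sequentially_bot)
  \<comment> \<open>Refines \<open>sequentially\<close> so that \<open>p\<close> converges to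
    \<open>l\<close>; it is nontrivial because \<open>l\<close> is a cluster point.\<close>
  define F where "F = inf sequentially (filtercomap p (nhds l))"
  have F_bot: "F \<noteq> bot"
  proof
    assume "F = bot"
    then obtain A B where AB: "eventually A sequentially" "eventually B (nhds l)" "\<And>n. A n \<Longrightarrow> \<not> B (p n)"
      unfolding F_def trivial_limit_def eventually_inf eventually_filtercomap by blast
    then have "eventually (\<lambda>x. \<not> B x) (filtermap p sequentially)"
      unfolding eventually_filtermap by (auto elim: eventually_mono)
    then have "eventually (\<lambda>_. False) (inf (nhds l) (filtermap p sequentially))"
      using AB(2) unfolding eventually_inf by blast
    then show False using l by (simp add: trivial_limit_def)
  qed
  have F_seq: "F \<le> sequentially" by (simp add: F_def)
  have lim: "((\<lambda>n. avg f n) \<longlongrightarrow> l f) F" if "Bseq f" for f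
  proof -
    have "filterlim p (nhds l) F"
      unfolding F_def filterlim_def
      by (rule order_trans[OF filtermap_mono[OF inf_le2] filtermap_filtercomap])
    moreover have "((\<lambda>x. x f) \<longlongrightarrow> l f) (nhds l)"
      using continuous_on_product_coordinates[of f]
      by (metis UNIV_I continuous_on_def tendsto_at_iff_tendsto_nhds)
    ultimately have "((\<lambda>n. p n f) \<longlongrightarrow> l f) F"
      by (rule filterlim_compose[rotated])
    then show ?thesis by (simp add: p_def that)
  qed
  have uniq: "x = y" if "(f \<longlongrightarrow> x) F" "(f \<longlongrightarrow> y) F" for f :: "nat \<Rightarrow> real" and x y
    using tendsto_unique[OF F_bot] that by blast
  have vanish: "((\<lambda>n. c / real n) \<longlongrightarrow> 0) F" for c
    by (rule tendsto_mono[OF F_seq]) (rule lim_const_over_n)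
  have add: "l (\<lambda>n. f n + g n) = l f + l g" if "Bseq f" "Bseq g" for f g
  proof -
    have "Bseq (\<lambda>n. f n + g n)"
      using that by (metis Bseq_eq_bounded bounded_plus_comp)
    from lim[OF this] tendsto_add[OF lim[OF that(1)] lim[OF that(2)]] show ?thesis
      by (intro uniq) (simp_all add: avg_def sum.distrib add_divide_distrib)
  qed
  have scale: "l (\<lambda>n. c * f n) = c * l f" if "Bseq f" for c f
  proof -
    have "Bseq (\<lambda>n. c * f n)"
      using that by (intro Bseq_mult) auto
    from lim[OF this] tendsto_mult_left[OF lim[OF that], of c] show ?thesis
      by (intro uniq) (simp_all add: avg_def flip: sum_distrib_left)
  qed
  have shift: "l (\<lambda>n. f (Suc n)) = l f" if "Bseq f" for f
  proof -
    have B: "Bseq (\<lambda>n. f (Suc n))" using that by (simp add: Bseq_Suc_iff)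
    have eq: "avg (\<lambda>n. f (Suc n)) n - avg f n = (f n - f 0) / real n" for n
    proof -
      have "(\<Sum>k<n. f (Suc k)) + f 0 = (\<Sum>k<Suc n. f k)"
        by (subst sum.lessThan_Suc_shift) simp
      then show ?thesis by (simp add: avg_def diff_divide_distrib[symmetric])
    qed
    have "((\<lambda>n. (f n - f 0) / real n) \<longlongrightarrow> 0) F"
    proof (rule Lim_null_comparison[OF _ vanish[of "2 * C f"]])
      have "norm ((f n - f 0) / real n) \<le> 2 * C f / real n" for n
        using C[OF that, of n] C[OF that, of 0] by (auto simp: abs_div intro!: divide_right_mono)
      then show "\<forall>\<^sub>F n in F. norm ((f n - f 0) / real n) \<le> 2 * C f / real n" by simp
    qed
    then have "((\<lambda>n. avg (\<lambda>n. f (Suc n)) n - avg f n) \<longlongrightarrow> 0) F" by (simp add: eq)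
    with tendsto_diff[OF lim[OF B] lim[OF that]] have "l (\<lambda>n. f (Suc n)) - l f = 0"
      by (rule uniq)
    then show ?thesis by simp
  qed
  have mono: "l f \<le> l g" if "Bseq f" "Bseq g" "\<And>n. f n \<le> g n" for f g
  proof (rule tendsto_le[OF F_bot lim[OF that(2)] lim[OF that(1)]])
    show "\<forall>\<^sub>F n in F. avg f n \<le> avg g n"
      by (intro always_eventually allI) (auto simp: avg_def intro!: divide_right_mono sum_mono that(3))
  qed
  \<comment> \<open>Discards an initial segment, so that the order property needs the comparison
    only for large \<open>n\<close>.\<close>
  have shiftN: "l (\<lambda>n. f (n + N)) = l f" if "Bseq f" for f N
  proof (induction N)
    case (Suc N)
    have "Bseq (\<lambda>n. f (n + N))" using that by (simp add: Bseq_ignore_initial_segment)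
    from shift[OF this] Suc show ?case by simp
  qed simp
  have const: "l (\<lambda>n. c) = c" for c
  proof -
    have "((\<lambda>n. avg (\<lambda>_. c) n) \<longlongrightarrow> c) F"
    proof (rule tendsto_mono[OF F_seq], rule tendsto_eventually)
      show "\<forall>\<^sub>F n in sequentially. avg (\<lambda>_. c) n = c"
        using eventually_gt_at_top[of 0] by eventually_elim (simp add: avg_def)
    qed
    then show ?thesis using lim[of "\<lambda>_. c"] uniq by (simp add: Bseq_def)
  qed
  show thesis
  proof (rule that[of l])
    show "l f \<le> l g" if "Bseq f" "Bseq g" "\<And>n. n \<ge> N \<Longrightarrow> f n \<le> g n" for f g N
      using mono[of "\<lambda>n. f (n + N)" "\<lambda>n. g (n + N)"] that
      by (simp add: shiftN Bseq_ignore_initial_segment)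
  qed (use add scale shift const in simp_all)
qed

section \<open>Sums as integrals over counting measures\<close>

lemma nn_integral_count_space_Un:
  assumes "A \<inter> B = {}"
  shows "(\<integral>\<^sup>+x. f x \<partial>count_space (A \<union> B)) = (\<integral>\<^sup>+x. f x \<partial>count_space A) + (\<integral>\<^sup>+x. f x \<partial>count_space B)"
  using nn_integral_disjoint_pair_countspace[OF assms, of f]
  by (simp add: nn_integral_count_space_indicator)

lemma nn_integral_count_space_mono:
  fixes f :: "'a \<Rightarrow> ennreal"
  assumes "A \<subseteq> B"
  shows "(\<integral>\<^sup>+x. f x \<partial>count_space A) \<le> (\<integral>\<^sup>+x. f x \<partial>count_space B)"
  using assms unfolding nn_integral_count_space_indicator
  by (auto simp: nn_integral_count_space_indicator intro!: nn_integral_mono split: split_indicator)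

lemma nn_integral_count_space_image_le:
  fixes f :: "'b \<Rightarrow> ennreal"
  shows "(\<integral>\<^sup>+z. f z \<partial>count_space (T ` A)) \<le> (\<integral>\<^sup>+x. f (T x) \<partial>count_space A)"
proof -
  obtain B where B: "B \<subseteq> A" "inj_on T B" "T ` A = T ` B"
    by (metis subset_image_inj subset_refl)
  have "(\<integral>\<^sup>+z. f z \<partial>count_space (T ` A)) = (\<integral>\<^sup>+x. f (T x) \<partial>count_space B)"
    using B by (intro nn_integral_bij_count_space[symmetric]) (auto simp: bij_betw_def)
  also have "\<dots> \<le> (\<integral>\<^sup>+x. f (T x) \<partial>count_space A)"
    by (rule nn_integral_count_space_mono[OF B(1)])
  finally show ?thesis .
qed

lemma nn_integral_count_space_image:
  fixes f :: "'b \<Rightarrow> ennreal"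
  assumes "inj_on T A"
  shows "(\<integral>\<^sup>+z. f z \<partial>count_space (T ` A)) = (\<integral>\<^sup>+x. f (T x) \<partial>count_space A)"
  using assms by (intro nn_integral_bij_count_space[symmetric]) (auto simp: bij_betw_def)

text \<open>Tonelli over the pairs (x, T x). In \<open>transfer\<close> the fibre sizes on the right
  become entries of the transition matrix.\<close>

lemma nn_integral_count_space_fibres:
  fixes f :: "'b \<Rightarrow> ennreal"
  shows "(\<integral>\<^sup>+x. f (T x) \<partial>count_space A) =
    (\<integral>\<^sup>+z. f z * emeasure (count_space UNIV) {x\<in>A. T x = z} \<partial>count_space UNIV)"
proof -
  define h where "h = (\<lambda>(x, z). f z * indicator {x\<in>A. T x = z} x)"
  have "(\<integral>\<^sup>+x. f (T x) \<partial>count_space A) = (\<integral>\<^sup>+x. f (T x) * indicator A x \<partial>count_space UNIV)"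
    by (rule nn_integral_count_space_indicator) simp
  also have "\<dots> = (\<integral>\<^sup>+x. \<integral>\<^sup>+z. h (x, z) \<partial>count_space UNIV \<partial>count_space UNIV)"
  proof (rule nn_integral_cong)
    fix x
    have "(\<integral>\<^sup>+z. h (x, z) \<partial>count_space UNIV) = (\<Sum>z\<in>{T x}. h (x, z))"
      by (rule nn_integral_count_space') (auto simp: h_def)
    also have "\<dots> = f (T x) * indicator A x"
      by (simp add: h_def indicator_def)
    finally show "f (T x) * indicator A x = (\<integral>\<^sup>+z. h (x, z) \<partial>count_space UNIV)" ..
  qed
  also have "\<dots> = (\<integral>\<^sup>+z. \<integral>\<^sup>+x. h (x, z) \<partial>count_space UNIV \<partial>count_space UNIV)"
    by (simp only: nn_integral_fst_count_space nn_integral_snd_count_space)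
  also have "\<dots> = (\<integral>\<^sup>+z. f z * emeasure (count_space UNIV) {x\<in>A. T x = z} \<partial>count_space UNIV)"
    unfolding h_def by (intro nn_integral_cong) (simp add: nn_integral_cmult nn_integral_indicator)
  finally show ?thesis .
qed

section \<open>Maximal intervals of monotonicity\<close>

lemma monotone_map_on_minus: "monotone_map_on J (\<lambda>x. - T x) \<longleftrightarrow> monotone_map_on J T"
  by (auto simp: monotone_map_on_def monotone_on_def)

lemma monotone_map_on_subset: "monotone_map_on J T \<Longrightarrow> K \<subseteq> J \<Longrightarrow> monotone_map_on K T"
  unfolding monotone_map_on_def monotone_on_def by blast

text \<open>The common pair \<open>p < q\<close> with distinct values forces one direction on all
  members; points of two members are then compared through \<open>p\<close> or \<open>q\<close>.
  Without such a pair an increasing and a decreasing member could overlap where \<open>T\<close> is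
  constant, and maximal intervals would not be unique.\<close>

lemma monotone_map_on_Union:
  assumes K: "\<And>K. K \<in> \<K> \<Longrightarrow> is_interval K \<and> p \<in> K \<and> q \<in> K \<and> monotone_map_on K T"
    and "p < q" "T p \<noteq> T q"
  shows "monotone_map_on (\<Union>\<K>) T"
proof -
  \<comment> \<open>\<open>U\<close> is \<open>T\<close> or its negative, whichever increases from
    \<open>p\<close> to \<open>q\<close>.\<close>
  have *: "monotone_map_on (\<Union>\<K>) U"
    if U: "\<And>K. K \<in> \<K> \<Longrightarrow> monotone_map_on K U" and less: "U p < U q" for U
  proof -
    have mono: "mono_on K U" if "K \<in> \<K>" for K
    proof -
      have "\<not> antimono_on K U"
        using K[OF that] less \<open>p < q\<close> unfolding monotone_on_def by fastforce
      then show ?thesis using U[OF that] by (simp add: monotone_map_on_def)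
    qed
    have "U s \<le> U t" if st: "s \<in> A" "A \<in> \<K>" "t \<in> B" "B \<in> \<K>" "s \<le> t" for s t A B
    proof -
      have iv: "x \<in> D" if "D \<in> \<K>" "u \<in> D" "v \<in> D" "u \<le> x" "x \<le> v" for D u v x
        using K[OF that(1)] that unfolding is_interval_1 by blast
      have le: "U x \<le> U y" if "D \<in> \<K>" "x \<in> D" "y \<in> D" "x \<le> y" for D x y
        using mono[OF that(1)] that by (auto simp: monotone_on_def)
      consider "s \<le> p" "p \<le> t" | "p < s" | "t < p" by linarith
      then show ?thesis
      proof cases
        case 1
        then show ?thesis using le[of A s p] le[of B p t] K st by fastforce
      next
        case 2
        then show ?thesis using le[of B s t] iv[of B p t s] K st by fastforce
      next
        case 3
        then show ?thesis using le[of A s t] iv[of A s p t] K st by fastforce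
      qed
    qed
    then show ?thesis by (auto simp: monotone_map_on_def monotone_on_def)
  qed
  show ?thesis
  proof (cases "T p < T q")
    case True
    then show ?thesis using * K by blast
  next
    case False
    then have "monotone_map_on (\<Union>\<K>) (\<lambda>x. - T x)"
      using * [of "\<lambda>x. - T x"] K \<open>T p \<noteq> T q\<close> by (force simp: monotone_map_on_minus)
    then show ?thesis by (simp add: monotone_map_on_minus)
  qed
qed

lemma maximal_monotonicity_interval_exists:
  assumes "is_interval K" "K \<subseteq> i" "monotone_map_on K T" "p \<in> K" "q \<in> K" "p < q" "T p \<noteq> T q"
  obtains J where "maximal_monotonicity_interval T i J" "K \<subseteq> J"
proof -
  define \<K> where "\<K> = {J. is_interval J \<and> K \<subseteq> J \<and> J \<subseteq> i \<and> monotone_map_on J T}"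
  have K: "K \<in> \<K>" using assms by (auto simp: \<K>_def)
  have "monotone_map_on (\<Union>\<K>) T"
    using assms by (intro monotone_map_on_Union[of _ p q]) (auto simp: \<K>_def)
  moreover have "is_interval (\<Union>\<K>)"
    unfolding is_interval_connected_1
    using assms by (intro connected_Union) (auto simp: \<K>_def is_interval_connected_1)
  ultimately have "maximal_monotonicity_interval T i (\<Union>\<K>)"
    unfolding maximal_monotonicity_interval_def using K
    by (auto simp: \<K>_def)
  then show thesis using that K by blast
qed

lemma maximal_monotonicity_interval_unique:
  assumes J: "maximal_monotonicity_interval T i J" and K: "maximal_monotonicity_interval T i K"
    and "p \<in> J \<inter> K" "q \<in> J \<inter> K" "p < q" "T p \<noteq> T q"
  shows "J = K"
proof -
  have "monotone_map_on (\<Union>{J, K}) T"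
    using assms by (intro monotone_map_on_Union[of _ p q]) (auto simp: maximal_monotonicity_interval_def)
  moreover have "is_interval (\<Union>{J, K})"
    unfolding is_interval_connected_1
    using assms by (intro connected_Union) (auto simp: maximal_monotonicity_interval_def is_interval_connected_1)
  ultimately have "J \<union> K = J" "J \<union> K = K"
    using J K unfolding maximal_monotonicity_interval_def by simp_all
  then show ?thesis by simp
qed

lemma inj_monotone_cases:
  assumes "monotone_map_on J T" "inj_on T J"
  obtains "\<And>x y. x \<in> J \<Longrightarrow> y \<in> J \<Longrightarrow> x < y \<Longrightarrow> T x < T y"
    | "\<And>x y. x \<in> J \<Longrightarrow> y \<in> J \<Longrightarrow> x < y \<Longrightarrow> T y < T x"
proof -
  have ne: "T x \<noteq> T y" if "x \<in> J" "y \<in> J" "x < y" for x y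
    using assms(2) that by (auto simp: inj_on_def)
  from assms(1) show thesis
    unfolding monotone_map_on_def monotone_on_def
  proof
    assume *: "\<forall>x\<in>J. \<forall>y\<in>J. x \<le> y \<longrightarrow> T x \<le> T y"
    have "T x < T y" if "x \<in> J" "y \<in> J" "x < y" for x y
      using * ne[OF that] that by (simp add: less_le)
    then show thesis by (rule that(1))
  next
    assume *: "\<forall>x\<in>J. \<forall>y\<in>J. x \<le> y \<longrightarrow> T y \<le> T x"
    have "T y < T x" if "x \<in> J" "y \<in> J" "x < y" for x y
      using * ne[OF that] that by (simp add: less_le)
    then show thesis by (rule that(2))
  qed
qed

lemma monotone_image_halfopen:
  fixes T :: "real \<Rightarrow> real"
  assumes cont: "continuous_on {a..b} T" and mono: "monotone_map_on {a..b} T" "inj_on T {a..b}"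
    and "a \<le> b"
  shows "T a \<le> T b \<and> T ` {a<..b} = {T a<..T b} \<or> T b \<le> T a \<and> T ` {a<..b} = {T b..<T a}"
proof (rule inj_monotone_cases[OF mono])
  assume inc: "\<And>x y. x \<in> {a..b} \<Longrightarrow> y \<in> {a..b} \<Longrightarrow> x < y \<Longrightarrow> T x < T y"
  have "T ` {a<..b} \<subseteq> {T a<..T b}"
  proof
    fix z assume "z \<in> T ` {a<..b}"
    then obtain x where "z = T x" "a < x" "x \<le> b" by auto
    then show "z \<in> {T a<..T b}" using inc[of a x] inc[of x b] by (cases "x = b") auto
  qed
  moreover have "{T a<..T b} \<subseteq> T ` {a<..b}"
  proof
    fix z assume z: "z \<in> {T a<..T b}"
    then obtain x where "a \<le> x" "x \<le> b" "T x = z"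
      using IVT'[of T a z b] cont \<open>a \<le> b\<close> by auto
    then show "z \<in> T ` {a<..b}" using z by (cases "x = a") auto
  qed
  ultimately show ?thesis using inc[of a b] \<open>a \<le> b\<close> by (cases "a = b") auto
next
  assume dec: "\<And>x y. x \<in> {a..b} \<Longrightarrow> y \<in> {a..b} \<Longrightarrow> x < y \<Longrightarrow> T y < T x"
  have "T ` {a<..b} \<subseteq> {T b..<T a}"
  proof
    fix z assume "z \<in> T ` {a<..b}"
    then obtain x where "z = T x" "a < x" "x \<le> b" by auto
    then show "z \<in> {T b..<T a}" using dec[of a x] dec[of x b] by (cases "x = b") auto
  qed
  moreover have "{T b..<T a} \<subseteq> T ` {a<..b}"
  proof
    fix z assume z: "z \<in> {T b..<T a}"
    then obtain x where "a \<le> x" "x \<le> b" "T x = z"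
      using IVT2'[of T b z a] cont \<open>a \<le> b\<close> by auto
    then show "z \<in> T ` {a<..b}" using z by (cases "x = a") auto
  qed
  ultimately show ?thesis using dec[of a b] \<open>a \<le> b\<close> by (cases "a = b") auto
qed

section \<open>Cells, generic points and fibre counts\<close>

locale leo_markov_map =
  fixes T :: "real \<Rightarrow> real" and P :: "real set set"
  assumes interval_map: "interval_map T" and markov: "markov_partition T P" and leo: "leo T"
begin

abbreviation M :: "real set \<Rightarrow> real set \<Rightarrow> real" where "M \<equiv> transition_matrix T"

text \<open>
  The generic set \<open>G\<close> is backward invariant and misses all cell boundaries. Over its points the
  transition matrix counts preimages in a cell, so powers of the matrix count preimages under
  iterates, and no intervals have to be tracked.
\<close>

definition E :: "real set" where "E = {0..1} - (\<Union>i\<in>P. interior i)"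

definition G :: "real set" where "G = {x\<in>{0..1}. \<forall>n. x \<notin> (T ^^ n) ` E}"

lemma cont: "continuous_on {0..1} T"
  using interval_map by (simp add: interval_map_def)

lemma in_unit: "x \<in> {0..1} \<Longrightarrow> T x \<in> {0..1}"
  using interval_map unfolding interval_map_def by blast

lemma funpow_in_unit: "x \<in> {0..1} \<Longrightarrow> (T ^^ n) x \<in> {0..1}"
  by (induction n) (use in_unit in auto)

lemma cont_funpow: "continuous_on {0..1} (T ^^ n)"
proof (induction n)
  case (Suc n)
  have "(T ^^ n) ` {0..1} \<subseteq> {0..1}" using funpow_in_unit by blast
  then have "continuous_on {0..1} (T \<circ> (T ^^ n))"
    by (intro continuous_on_compose Suc continuous_on_subset[OF cont])
  then show ?case by simp
qed (simp add: continuous_on_id)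

lemma countable_P: "countable P"
  using markov by (simp add: markov_partition_def)

lemma interval_P:
  assumes "i \<in> P" obtains a b where "0 \<le> a" "a < b" "b \<le> 1" "i = {a..b}"
proof -
  have "\<forall>i\<in>P. \<exists>a b. 0 \<le> a \<and> a < b \<and> b \<le> 1 \<and> i = {a..b}"
    using markov by (simp add: markov_partition_def)
  then show thesis using assms that by blast
qed

lemma P_subset_unit: "i \<in> P \<Longrightarrow> i \<subseteq> {0..1}"
  by (auto elim: interval_P)

lemma interior_disjoint: "i \<in> P \<Longrightarrow> j \<in> P \<Longrightarrow> i \<noteq> j \<Longrightarrow> interior i \<inter> interior j = {}"
  using markov by (auto simp: markov_partition_def pairwise_def)

lemma disjoint_interior:
  assumes "i \<in> P" "j \<in> P" "i \<noteq> j"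
  shows "i \<inter> interior j = {}"
proof -
  obtain a b where "a < b" "i = {a..b}" using interval_P[OF assms(1)] by metis
  then have "closure (interior i) = i" by (simp add: interior_atLeastAtMost_real closure_greaterThanLessThan)
  then show ?thesis
    using open_Int_closure_eq_empty[of "interior j" "interior i"] interior_disjoint[OF assms] by auto
qed

lemma countable_E: "countable E"
proof -
  have sub: "E \<subseteq> ({0..1} - \<Union>P) \<union> (\<Union>i\<in>P. i - interior i)" by (auto simp: E_def)
  have "countable (i - interior i)" if i: "i \<in> P" for i
  proof -
    obtain a b where "a < b" "i = {a..b}" using interval_P[OF i] by metis
    then have "i - interior i \<subseteq> {a, b}" by (auto simp: interior_atLeastAtMost_real)
    then show ?thesis by (rule countable_subset) simp
  qed
  then have "countable (\<Union>i\<in>P. i - interior i)" using countable_P by simp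
  moreover have "countable ({0..1} - \<Union>P)" using markov by (simp add: markov_partition_def)
  ultimately show ?thesis using countable_subset[OF sub] by blast
qed

lemma not_E_interior:
  assumes "x \<in> {0..1}" "x \<notin> E" obtains i where "i \<in> P" "x \<in> interior i"
  using assms by (auto simp: E_def)

lemma not_E_in_interior:
  assumes "i \<in> P" "x \<in> i" "x \<notin> E" shows "x \<in> interior i"
  using assms P_subset_unit disjoint_interior by (metis disjoint_iff not_E_interior subsetD)

lemma G_subset: "G \<subseteq> {0..1}" by (auto simp: G_def)

lemma G_not_E: "x \<in> G \<Longrightarrow> x \<notin> E"
  by (auto simp: G_def dest: spec[of _ 0])

lemma G_backward:
  assumes "x \<in> {0..1}" "T x \<in> G" shows "x \<in> G"
proof -
  have False if "x \<in> (T ^^ n) ` E" for n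
  proof -
    from that have "T x \<in> (T ^^ Suc n) ` E" by auto
    then show False using assms(2) by (auto simp: G_def simp del: funpow.simps)
  qed
  then show ?thesis using assms(1) by (auto simp: G_def)
qed

lemma G_funpow_backward:
  assumes "x \<in> {0..1}" "(T ^^ n) x \<in> G" shows "x \<in> G"
  using assms
proof (induction n)
  case (Suc n)
  then show ?case using G_backward[of "(T ^^ n) x"] funpow_in_unit[of x n] by simp
qed simp

lemma countable_not_G: "countable ({0..1} - G)"
proof -
  have "{0..1} - G \<subseteq> (\<Union>n. (T ^^ n) ` E)" by (auto simp: G_def)
  then show ?thesis by (rule countable_subset) (simp add: countable_E)
qed

lemma G_cell:
  assumes "x \<in> G" obtains i where "i \<in> P" "x \<in> interior i"
  using assms G_subset G_not_E not_E_interior by (metis subsetD)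

lemma G_cell_unique: "x \<in> G \<Longrightarrow> i \<in> P \<Longrightarrow> j \<in> P \<Longrightarrow> x \<in> i \<Longrightarrow> x \<in> j \<Longrightarrow> i = j"
  using not_E_in_interior G_not_E disjoint_interior by blast

lemma ex_generic:
  assumes "j \<in> P" shows "\<exists>c. c \<in> j \<inter> G"
proof (rule ccontr)
  assume "\<nexists>c. c \<in> j \<inter> G"
  then have "j \<subseteq> {0..1} - G" using P_subset_unit[OF assms] by auto
  then have "countable j" using countable_not_G countable_subset by blast
  moreover obtain a b where "a < b" "j = {a..b}" using interval_P[OF assms] by metis
  ultimately show False using uncountable_closed_interval[of a b] by simp
qed

lemma P_nonempty: "P \<noteq> {}"
proof
  assume "P = {}"
  then have "E = {0..1}" unfolding E_def by simp
  then have "countable {0..1::real}" using countable_E by metis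
  then show False using uncountable_closed_interval[of 0 "1::real"] by simp
qed

lemma onto: "T ` {0..1} = {0..1}"
proof -
  \<comment> \<open>This set omits 1, so the iterate that covers the unit interval is not the zeroth
    one and a factor \<open>T\<close> can be split off.\<close>
  have "openin (top_of_set {0..1::real}) ({0..1} \<inter> {..<1/2})" by (simp add: openin_open_Int)
  moreover have "0 \<in> {0..1} \<inter> {..<1/2::real}" by simp
  ultimately obtain n where n: "(T ^^ n) ` ({0..1} \<inter> {..<1/2}) = {0..1}"
    using leo unfolding leo_def by blast
  have "1 \<in> (T ^^ n) ` ({0..1} \<inter> {..<1/2})" by (simp add: n)
  then obtain m where m: "n = Suc m" by (cases n) auto
  have "{0..1} \<subseteq> T ` {0..1}"
  proof
    fix x :: real assume "x \<in> {0..1}"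
    then have "x \<in> (T ^^ n) ` ({0..1} \<inter> {..<1/2})" by (simp only: n)
    then obtain y where y: "y \<in> {0..1}" "(T ^^ n) y = x" by blast
    then have "T ((T ^^ m) y) = x" by (simp add: m)
    then show "x \<in> T ` {0..1}" using funpow_in_unit[OF y(1)] by blast
  qed
  then show ?thesis using in_unit by blast
qed

lemma funpow_onto: "(T ^^ n) ` {0..1} = {0..1}"
proof (induction n)
  case (Suc n)
  have "(T ^^ Suc n) ` {0..1} = T ` (T ^^ n) ` {0..1}" by (simp add: image_comp)
  then show ?case by (simp only: Suc onto)
qed simp

lemma eventually_onto:
  assumes "openin (top_of_set {0..1}) U" "U \<noteq> {}"
  obtains q where "\<And>n. n \<ge> q \<Longrightarrow> (T ^^ n) ` U = {0..1}"
proof -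
  obtain q where q: "(T ^^ q) ` U = {0..1}" using leo assms unfolding leo_def by blast
  have "(T ^^ n) ` U = {0..1}" if "n \<ge> q" for n
  proof -
    have "(T ^^ n) ` U = (T ^^ (n - q)) ` (T ^^ q) ` U"
      using that by (simp add: image_comp funpow_add[symmetric])
    then show ?thesis by (simp add: q funpow_onto)
  qed
  then show thesis using that by blast
qed

lemma openin_Ioo: "0 \<le> a \<Longrightarrow> b \<le> 1 \<Longrightarrow> openin (top_of_set {0..1}) {a<..<b::real}"
  unfolding openin_open by (rule exI[of _ "{a<..<b}"]) auto

lemma not_constant:
  assumes "0 \<le> p" "p < q" "q \<le> 1"
  shows "\<not> (\<forall>x\<in>{p..q}. T x = c)"
proof
  assume c: "\<forall>x\<in>{p..q}. T x = c"
  have "{p<..<q} \<noteq> {}" using assms by simp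
  then obtain n0 where n0: "\<And>n. n \<ge> n0 \<Longrightarrow> (T ^^ n) ` {p<..<q} = {0..1}"
    using eventually_onto[OF openin_Ioo] assms by metis
  have "(T ^^ Suc n0) ` {p<..<q} \<subseteq> {(T ^^ n0) c}"
    using c by (auto simp del: funpow.simps simp: funpow_Suc_right)
  then have "{0..1} \<subseteq> {(T ^^ n0) c}" using n0[of "Suc n0"] by simp
  moreover have "(0::real) \<in> {0..1}" "(1::real) \<in> {0..1}" by auto
  ultimately have "0 = (T ^^ n0) c" "1 = (T ^^ n0) c" by blast+
  then show False by simp
qed

text \<open>A weakly monotone map that takes a value twice is constant in between, and an interval
  of constancy never grows to the unit interval. Hence weak monotonicity is strict for leo
  maps.\<close>

lemma monotone_inj:
  assumes "is_interval J" "J \<subseteq> {0..1}" "monotone_map_on J T"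
  shows "inj_on T J"
proof -
  have ne: "T x \<noteq> T y" if xy: "x < y" "x \<in> J" "y \<in> J" for x y
  proof
    assume eq: "T x = T y"
    have "T z = T x" if z: "z \<in> {x..y}" for z
    proof -
      have zJ: "z \<in> J" using mem_is_interval_1_I[OF assms(1) xy(2,3), of z] z by simp
      have "T x \<le> T z \<and> T z \<le> T y \<or> T y \<le> T z \<and> T z \<le> T x"
        using assms(3) unfolding monotone_map_on_def
      proof
        assume "mono_on J T"
        then show ?thesis using xy z zJ monotone_onD[of J "(\<le>)" "(\<le>)" T] by auto
      next
        assume "antimono_on J T"
        then show ?thesis using xy z zJ monotone_onD[of J "(\<le>)" "(\<ge>)" T] by auto
      qed
      then show ?thesis using eq by linarith
    qed
    moreover have "x \<in> {0..1}" "y \<in> {0..1}" using xy assms(2) by blast+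
    ultimately show False using not_constant[of x y "T x"] xy(1) by (meson atLeastAtMost_iff)
  qed
  show ?thesis
  proof (rule inj_onI)
    fix x y assume "x \<in> J" "y \<in> J" "T x = T y"
    then show "x = y" using ne[of x y] ne[of y x] by (cases x y rule: linorder_cases) auto
  qed
qed

lemma monotone_pieces:
  assumes "i \<in> P"
  obtains Q where "finite Q" "\<Union>Q = i"
    "\<And>K. K \<in> Q \<Longrightarrow> \<exists>u v. u < v \<and> K = {u..v} \<and> monotone_map_on K T \<and> inj_on T K"
proof -
  obtain a b where ab: "a < b" "i = {a..b}" using interval_P[OF assms] by metis
  have "piecewise_monotone_on i T" using markov assms by (simp add: markov_partition_def)
  then obtain Q where Q: "Q division_of i" "\<forall>K\<in>Q. monotone_map_on K T"
    unfolding piecewise_monotone_on_def by blast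
  \<comment> \<open>A division may contain degenerate pieces. Without them every piece has two end
    points, whose values differ by injectivity.\<close>
  define Q' where "Q' = {K \<in> Q. measure lborel K \<noteq> 0}"
  have div: "Q' division_of i"
    using division_of_nontrivial[of Q a b] Q(1) ab by (simp add: Q'_def content_real_eq_0)
  show thesis
  proof (rule that[of Q'])
    show "finite Q'" "\<Union>Q' = i" using div by auto
    fix K assume K: "K \<in> Q'"
    then obtain u v where uv: "K = cbox u v" using division_ofD(4)[OF div] by metis
    have "u < v" using K uv by (auto simp: Q'_def content_real_eq_0 not_le split: if_splits)
    moreover have "K \<subseteq> {0..1}" using division_ofD(2)[OF div K] P_subset_unit[OF assms] by blast
    ultimately show "\<exists>u v. u < v \<and> K = {u..v} \<and> monotone_map_on K T \<and> inj_on T K"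
      using Q(2) K uv monotone_inj[of K] by (auto simp: Q'_def is_interval_cc)
  qed
qed

lemma maximal_at:
  assumes "i \<in> P" "x \<in> i"
  obtains J where "maximal_monotonicity_interval T i J" "x \<in> J"
proof -
  obtain Q where Q: "\<Union>Q = i"
    "\<And>K. K \<in> Q \<Longrightarrow> \<exists>u v. u < v \<and> K = {u..v} \<and> monotone_map_on K T \<and> inj_on T K"
    using monotone_pieces[OF assms(1)] by metis
  obtain K where K: "K \<in> Q" "x \<in> K" using assms(2) Q(1) by blast
  then obtain u v where uv: "u < v" "K = {u..v}" "monotone_map_on K T" "inj_on T K" using Q(2) by metis
  have "T u \<noteq> T v" using uv inj_onD[OF uv(4), of u v] by auto
  then obtain J where "maximal_monotonicity_interval T i J" "K \<subseteq> J"
    using uv K Q(1) by (auto intro: maximal_monotonicity_interval_exists[of K i T u v] simp: is_interval_cc)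
  then show thesis using that K by blast
qed

lemma maximal_covers:
  assumes "i \<in> P" "j \<in> P" "maximal_monotonicity_interval T i J" "x \<in> J" "T x \<in> interior j"
  shows "j \<subseteq> T ` J"
proof -
  have "\<forall>i\<in>P. \<forall>j\<in>P. \<forall>J. maximal_monotonicity_interval T i J \<and> T ` J \<inter> interior j \<noteq> {}
        \<longrightarrow> j \<subseteq> T ` J"
    using markov by (simp add: markov_partition_def)
  moreover have "T ` J \<inter> interior j \<noteq> {}" using assms by blast
  ultimately show ?thesis using assms by blast
qed

lemma maximal_props:
  assumes "i \<in> P" "maximal_monotonicity_interval T i J"
  shows "is_interval J" "J \<subseteq> i" "monotone_map_on J T" "inj_on T J"
  using assms monotone_inj[of J] P_subset_unit[OF assms(1)]
  by (auto simp: maximal_monotonicity_interval_def)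

text \<open>Distinct preimages of \<open>y\<close> lie in distinct maximal monotonicity intervals,
  as \<open>T\<close> is injective on each; by the Markov property each of these covers
  \<open>j\<close>, so they compete in the maximum that defines the matrix entry. Conversely every
  competing interval has a preimage of \<open>y\<close> in its interior, and disjoint interiors have
  different ones.\<close>

lemma generic_fibre:
  assumes i: "i \<in> P" and j: "j \<in> P" and y: "y \<in> j" "y \<notin> E"
  shows "finite {x\<in>i. T x = y}" "M i j = real (card {x\<in>i. T x = y})"
proof -
  let ?X = "{x\<in>i. T x = y}"
  let ?good = "\<lambda>Q. finite Q \<and> pairwise (\<lambda>K L. interior K \<inter> interior L = {}) Q \<and>
             (\<forall>K\<in>Q. is_interval K \<and> K \<subseteq> i \<and> monotone_map_on K T \<and> j \<subseteq> T ` K)"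
  have yj: "y \<in> interior j" using not_E_in_interior j y by blast
  obtain a b where ab: "a < b" "j = {a..b}" using interval_P[OF j] by metis
  have ayb: "a < y" "y < b" using yj ab by (auto simp: interior_atLeastAtMost_real)
  show fin: "finite ?X"
  proof -
    obtain Q where Q: "finite Q" "\<Union>Q = i"
      "\<And>K. K \<in> Q \<Longrightarrow> \<exists>u v. u < v \<and> K = {u..v} \<and> monotone_map_on K T \<and> inj_on T K"
      using monotone_pieces[OF i] by metis
    have "finite {x\<in>K. T x = y}" if "K \<in> Q" for K
    proof -
      have "inj_on T K" using Q(3)[OF that] by blast
      then have "inj_on T {x\<in>K. T x = y}" by (rule inj_on_subset) auto
      moreover have "finite (T ` {x\<in>K. T x = y})" by (rule finite_subset[of _ "{y}"]) auto
      ultimately show ?thesis by (rule finite_imageD[rotated])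
    qed
    moreover have "?X = (\<Union>K\<in>Q. {x\<in>K. T x = y})" using Q(2) by auto
    ultimately show ?thesis using Q(1) by simp
  qed
  have "\<exists>J. maximal_monotonicity_interval T i J \<and> x \<in> J" if "x \<in> ?X" for x
    using maximal_at[OF i, of x] that by blast
  then obtain J where J: "\<And>x. x \<in> ?X \<Longrightarrow> maximal_monotonicity_interval T i (J x)" "\<And>x. x \<in> ?X \<Longrightarrow> x \<in> J x"
    by metis
  have cover: "j \<subseteq> T ` J x" if "x \<in> ?X" for x
    using maximal_covers[OF i j J[OF that]] that yj by simp
  have J_eq: "x = x'" if "x \<in> ?X" "x' \<in> ?X" "J x = J x'" for x x'
    using maximal_props(4)[OF i J(1)[OF that(1)]] J(2)[OF that(1)] J(2)[OF that(2)] that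
    by (auto simp: inj_on_def)
  \<comment> \<open>Overlapping interiors share two points, whose values differ by injectivity; such
    a pair determines the maximal interval.\<close>
  have J_disjoint: "interior (J x) \<inter> interior (J x') = {}" if x: "x \<in> ?X" "x' \<in> ?X" "J x \<noteq> J x'" for x x'
  proof (rule ccontr)
    assume "interior (J x) \<inter> interior (J x') \<noteq> {}"
    then obtain p where p: "p \<in> interior (J x) \<inter> interior (J x')" by blast
    then obtain e where e: "e > 0" "ball p e \<subseteq> interior (J x) \<inter> interior (J x')"
      by (meson open_Int open_contains_ball open_interior)
    have "p + e/2 \<in> ball p e" using e by (simp add: dist_real_def)
    then have "p + e/2 \<in> J x \<inter> J x'" "p \<in> J x \<inter> J x'" using e p interior_subset by blast+
    moreover from this have "T p \<noteq> T (p + e/2)"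
      using maximal_props(4)[OF i J(1)[OF x(1)]] e by (auto dest: inj_onD)
    ultimately have "J x = J x'"
      using maximal_monotonicity_interval_unique[OF J(1)[OF x(1)] J(1)[OF x(2)], of p "p + e/2"] e by simp
    then show False using x by simp
  qed
  have good: "?good (J ` ?X)"
  proof (intro conjI ballI)
    show "finite (J ` ?X)" using fin by simp
    show "pairwise (\<lambda>K L. interior K \<inter> interior L = {}) (J ` ?X)"
      unfolding pairwise_def using J_disjoint by blast
    fix K assume "K \<in> J ` ?X"
    then obtain x where x: "x \<in> ?X" "K = J x" by blast
    show "is_interval K" "K \<subseteq> i" "monotone_map_on K T" "j \<subseteq> T ` K"
      using maximal_props[OF i J(1)[OF x(1)]] cover[OF x(1)] x(2) by simp_all
  qed
  have card_J: "card (J ` ?X) = card ?X"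
    by (rule card_image) (use J_eq in \<open>auto intro: inj_onI simp del: mem_Collect_eq\<close>)
  have upper: "card Q \<le> card ?X" if Q: "?good Q" for Q
  proof -
    \<comment> \<open>As \<open>y\<close> is strictly between the ends of \<open>j\<close>, strict
      monotonicity puts its preimage strictly between two points of \<open>K\<close>.\<close>
    have "\<exists>x. x \<in> interior K \<and> x \<in> ?X" if K: "K \<in> Q" for K
    proof -
      have K': "is_interval K" "K \<subseteq> i" "monotone_map_on K T" "j \<subseteq> T ` K" using Q K by blast+
      have inj: "inj_on T K" using monotone_inj[OF K'(1) _ K'(3)] K'(2) P_subset_unit[OF i] by blast
      have "y \<in> T ` K" "a \<in> T ` K" "b \<in> T ` K" using K'(4) ab ayb by auto
      then obtain x s t where xst: "x \<in> K" "s \<in> K" "t \<in> K" "T x = y" "T s = a" "T t = b"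
        by blast
      have "s < x \<and> x < t \<or> t < x \<and> x < s"
      proof (rule inj_monotone_cases[OF K'(3) inj])
        assume *: "\<And>x y. x \<in> K \<Longrightarrow> y \<in> K \<Longrightarrow> x < y \<Longrightarrow> T x < T y"
        have "\<not> x < s" "\<not> t < x" "x \<noteq> s" "x \<noteq> t"
          using *[of x s] *[of t x] xst ayb by auto
        then show ?thesis by linarith
      next
        assume *: "\<And>x y. x \<in> K \<Longrightarrow> y \<in> K \<Longrightarrow> x < y \<Longrightarrow> T y < T x"
        have "\<not> s < x" "\<not> x < t" "x \<noteq> s" "x \<noteq> t"
          using *[of s x] *[of x t] xst ayb by auto
        then show ?thesis by linarith
      qed
      then obtain u v where uv: "u \<in> K" "v \<in> K" "u < x" "x < v" using xst by metis
      then have "{u..v} \<subseteq> K" using mem_is_interval_1_I[OF K'(1) uv(1,2)] by auto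
      then have "interior {u..v} \<subseteq> interior K" by (rule interior_mono)
      then have "x \<in> interior K" using uv by (auto simp: interior_atLeastAtMost_real)
      then show ?thesis using xst K'(2) by blast
    qed
    then obtain g where g: "\<And>K. K \<in> Q \<Longrightarrow> g K \<in> interior K" "\<And>K. K \<in> Q \<Longrightarrow> g K \<in> ?X" by metis
    have "inj_on g Q"
      using Q g(1) unfolding pairwise_def inj_on_def by (metis disjoint_iff)
    then show ?thesis using g(2) fin by (metis (no_types, lifting) card_inj_on_le image_subsetI)
  qed
  show "M i j = real (card ?X)"
  proof (cases "j \<subseteq> T ` i")
    case True
    have "Max {card Q | Q. ?good Q} = card ?X"
    proof (rule Max_eqI)
      show "finite {card Q | Q. ?good Q}"
        by (rule finite_subset[of _ "{..card ?X}"]) (use upper in auto)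
      show "n \<le> card ?X" if "n \<in> {card Q | Q. ?good Q}" for n
        using that upper by blast
      show "card ?X \<in> {card Q | Q. ?good Q}"
        unfolding mem_Collect_eq using good card_J[symmetric] by (intro exI[of _ "J ` ?X"] conjI) auto
    qed
    then show ?thesis using True by (simp add: transition_matrix_def)
  next
    case False
    have "?X = {}"
    proof (rule ccontr)
      assume "?X \<noteq> {}"
      then obtain x where x: "x \<in> ?X" by blast
      have "j \<subseteq> T ` i" using cover[OF x] maximal_props(2)[OF i J(1)[OF x]] by blast
      then show False using False by blast
    qed
    moreover have "M i j = 0" using False by (simp add: transition_matrix_def)
    ultimately show ?thesis by (simp only: card.empty of_nat_0)
  qed
qed

end

section \<open>Column-finite matrices and first entrances\<close>

text \<open>Rewrites the real sums of the definitions as \<open>ennreal\<close> integrals, in which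
  no summability has to be tracked.\<close>

lemma ennreal_infsum_finite_support:
  fixes f :: "'a \<Rightarrow> real"
  assumes fin: "finite {x\<in>I. f x \<noteq> 0}" and nn: "\<And>x. x \<in> I \<Longrightarrow> 0 \<le> f x"
  shows "ennreal (\<Sum>\<^sub>\<infinity>x\<in>I. f x) = (\<integral>\<^sup>+x. ennreal (f x) \<partial>count_space I)" "0 \<le> (\<Sum>\<^sub>\<infinity>x\<in>I. f x)"
proof -
  have eq: "(\<Sum>\<^sub>\<infinity>x\<in>I. f x) = (\<Sum>x\<in>{x\<in>I. f x \<noteq> 0}. f x)"
  proof -
    have "(\<Sum>\<^sub>\<infinity>x\<in>I. f x) = (\<Sum>\<^sub>\<infinity>x\<in>{x\<in>I. f x \<noteq> 0}. f x)"
      by (rule infsum_cong_neutral) auto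
    then show ?thesis using fin by simp
  qed
  then show "0 \<le> (\<Sum>\<^sub>\<infinity>x\<in>I. f x)" using nn by (auto intro: sum_nonneg)
  have "ennreal (\<Sum>\<^sub>\<infinity>x\<in>I. f x) = (\<Sum>x\<in>{x\<in>I. f x \<noteq> 0}. ennreal (f x))"
    unfolding eq by (rule sum_ennreal[symmetric]) (use nn in auto)
  also have "\<dots> = (\<integral>\<^sup>+x. ennreal (f x) \<partial>count_space I)"
    using fin by (intro nn_integral_count_space'[symmetric]) auto
  finally show "ennreal (\<Sum>\<^sub>\<infinity>x\<in>I. f x) = (\<integral>\<^sup>+x. ennreal (f x) \<partial>count_space I)" .
qed

lemma infsum_nonzero_term:
  fixes f :: "'a \<Rightarrow> real"
  assumes "(\<Sum>\<^sub>\<infinity>x\<in>I. f x) \<noteq> 0" obtains x where "x \<in> I" "f x \<noteq> 0"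
  using assms infsum_0[of I f] by blast

locale column_finite_matrix =
  fixes I :: "'a set" and M :: "'a \<Rightarrow> 'a \<Rightarrow> real"
  assumes M_nonneg: "i \<in> I \<Longrightarrow> j \<in> I \<Longrightarrow> 0 \<le> M i j"
    and finite_column: "j \<in> I \<Longrightarrow> finite {i\<in>I. M i j \<noteq> 0}"
begin

text \<open>\<open>J\<close> is \<open>I\<close> for the powers and \<open>I - {j}\<close> for the
  first entrances, so one induction step serves both. Finite support is passed on because the
  columns of \<open>M\<close> are finitely supported.\<close>

lemma mult_support:
  assumes "J \<subseteq> I" and v: "finite {\<alpha>\<in>I. v \<alpha> \<noteq> 0}" "\<And>\<alpha>. \<alpha> \<in> I \<Longrightarrow> 0 \<le> v \<alpha>"
  shows "finite {i\<in>I. (\<Sum>\<^sub>\<infinity>\<alpha>\<in>J. M i \<alpha> * v \<alpha>) \<noteq> 0}"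
    and "i \<in> I \<Longrightarrow> 0 \<le> (\<Sum>\<^sub>\<infinity>\<alpha>\<in>J. M i \<alpha> * v \<alpha>)"
    and "i \<in> I \<Longrightarrow> ennreal (\<Sum>\<^sub>\<infinity>\<alpha>\<in>J. M i \<alpha> * v \<alpha>) =
      (\<integral>\<^sup>+\<alpha>. ennreal (M i \<alpha>) * ennreal (v \<alpha>) \<partial>count_space J)"
proof -
  have "{i\<in>I. (\<Sum>\<^sub>\<infinity>\<alpha>\<in>J. M i \<alpha> * v \<alpha>) \<noteq> 0} \<subseteq> (\<Union>\<alpha>\<in>{\<alpha>\<in>I. v \<alpha> \<noteq> 0}. {i\<in>I. M i \<alpha> \<noteq> 0})"
  proof clarify
    fix i assume i: "i \<in> I" "(\<Sum>\<^sub>\<infinity>\<alpha>\<in>J. M i \<alpha> * v \<alpha>) \<noteq> 0"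
    obtain \<alpha> where "\<alpha> \<in> J" "M i \<alpha> * v \<alpha> \<noteq> 0" by (rule infsum_nonzero_term[OF i(2)])
    then show "i \<in> (\<Union>\<alpha>\<in>{\<alpha>\<in>I. v \<alpha> \<noteq> 0}. {i\<in>I. M i \<alpha> \<noteq> 0})" using i(1) assms(1) by auto
  qed
  moreover have "finite (\<Union>\<alpha>\<in>{\<alpha>\<in>I. v \<alpha> \<noteq> 0}. {i\<in>I. M i \<alpha> \<noteq> 0})"
    using v(1) finite_column by blast
  ultimately show "finite {i\<in>I. (\<Sum>\<^sub>\<infinity>\<alpha>\<in>J. M i \<alpha> * v \<alpha>) \<noteq> 0}" by (rule finite_subset)
  assume i: "i \<in> I"
  have fin: "finite {\<alpha>\<in>J. M i \<alpha> * v \<alpha> \<noteq> 0}"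
    by (rule finite_subset[OF _ v(1)]) (use assms(1) in auto)
  have nn: "0 \<le> M i \<alpha> * v \<alpha>" if "\<alpha> \<in> J" for \<alpha>
    using that assms(1) i by (intro mult_nonneg_nonneg M_nonneg v(2)) auto
  show "0 \<le> (\<Sum>\<^sub>\<infinity>\<alpha>\<in>J. M i \<alpha> * v \<alpha>)"
    by (rule ennreal_infsum_finite_support(2)[OF fin nn])
  have "ennreal (\<Sum>\<^sub>\<infinity>\<alpha>\<in>J. M i \<alpha> * v \<alpha>) = (\<integral>\<^sup>+\<alpha>. ennreal (M i \<alpha> * v \<alpha>) \<partial>count_space J)"
    by (rule ennreal_infsum_finite_support(1)[OF fin nn])
  also have "\<dots> = (\<integral>\<^sup>+\<alpha>. ennreal (M i \<alpha>) * ennreal (v \<alpha>) \<partial>count_space J)"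
    by (intro nn_integral_cong ennreal_mult) (use assms(1) i M_nonneg v(2) in auto)
  finally show "ennreal (\<Sum>\<^sub>\<infinity>\<alpha>\<in>J. M i \<alpha> * v \<alpha>) =
      (\<integral>\<^sup>+\<alpha>. ennreal (M i \<alpha>) * ennreal (v \<alpha>) \<partial>count_space J)" .
qed

lemma matrix_power_props:
  assumes "j \<in> I"
  shows "finite {i\<in>I. matrix_power I M n i j \<noteq> 0} \<and> (\<forall>i\<in>I. 0 \<le> matrix_power I M n i j)"
proof (induction n)
  case 0
  have "{i\<in>I. matrix_power I M 0 i j \<noteq> 0} \<subseteq> {j}" by auto
  then show ?case using finite_subset by fastforce
next
  case (Suc n)
  then show ?case using mult_support(1,2)[of I "\<lambda>\<alpha>. matrix_power I M n \<alpha> j"] by simp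
qed

lemma ennreal_matrix_power_Suc:
  assumes "i \<in> I" "j \<in> I"
  shows "ennreal (matrix_power I M (Suc n) i j) =
    (\<integral>\<^sup>+\<alpha>. ennreal (M i \<alpha>) * ennreal (matrix_power I M n \<alpha> j) \<partial>count_space I)"
  using mult_support(3)[of I "\<lambda>\<alpha>. matrix_power I M n \<alpha> j" i] matrix_power_props[OF assms(2), of n] assms
  by simp

lemma first_entrance_props:
  assumes "j \<in> I"
  shows "finite {i\<in>I. first_entrance I M (Suc n) i j \<noteq> 0} \<and> (\<forall>i\<in>I. 0 \<le> first_entrance I M (Suc n) i j)"
proof (induction n)
  case 0
  then show ?case using finite_column[OF assms] M_nonneg assms by simp
next
  case (Suc n)
  then show ?case
    using mult_support(1,2)[of "I - {j}" "\<lambda>\<alpha>. first_entrance I M (Suc n) \<alpha> j"] by simp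
qed

text \<open>\<open>w i\<close> is the generating function of the first entrances into
  \<open>j\<close> at \<open>R\<close>. Summing the recursion gives \<open>R\<close> times
  \<open>M i j\<close> plus the sum of \<open>M i \<alpha> * w \<alpha>\<close> over
  \<open>\<alpha> \<noteq> j\<close>. The missing term \<open>M i j * w j\<close> equals
  \<open>M i j\<close> exactly because \<open>w j = 1\<close>, which is recurrence. Other entries
  may still be infinite at this stage.\<close>

lemma first_entrance_eigenvector:
  assumes j: "j \<in> I" and R: "0 \<le> R"
    and sum1: "(\<lambda>n. first_entrance I M (Suc n) j j * R ^ Suc n) sums 1"
  obtains w :: "'a \<Rightarrow> ennreal" where "w j = 1"
    "\<And>i. i \<in> I \<Longrightarrow> w i = ennreal R * (\<integral>\<^sup>+\<alpha>. ennreal (M i \<alpha>) * w \<alpha> \<partial>count_space I)"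
proof -
  define w where "w i = (\<Sum>n. ennreal (first_entrance I M (Suc n) i j) * ennreal (R ^ Suc n))" for i
  note nn = first_entrance_props[OF j, THEN conjunct2, rule_format]
  have "w j = (\<Sum>n. ennreal (first_entrance I M (Suc n) j j * R ^ Suc n))"
    unfolding w_def using nn[OF j] R by (simp add: ennreal_mult)
  also have "\<dots> = ennreal 1"
    using sum1 nn[OF j] R by (intro suminf_ennreal_eq) auto
  finally have wj: "w j = 1" by simp
  have "w i = ennreal R * (\<integral>\<^sup>+\<alpha>. ennreal (M i \<alpha>) * w \<alpha> \<partial>count_space I)" if i: "i \<in> I" for i
  proof -
    have step: "ennreal (first_entrance I M (Suc (Suc n)) i j) * ennreal (R ^ Suc (Suc n)) =
      ennreal R * (\<integral>\<^sup>+\<alpha>. ennreal (M i \<alpha>) *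
        (ennreal (first_entrance I M (Suc n) \<alpha> j) * ennreal (R ^ Suc n)) \<partial>count_space (I - {j}))" for n
    proof -
      have "ennreal (first_entrance I M (Suc (Suc n)) i j) =
        (\<integral>\<^sup>+\<alpha>. ennreal (M i \<alpha>) * ennreal (first_entrance I M (Suc n) \<alpha> j) \<partial>count_space (I - {j}))"
        using mult_support(3)[of "I - {j}" "\<lambda>\<alpha>. first_entrance I M (Suc n) \<alpha> j" i]
          first_entrance_props[OF j, of n] i by simp
      moreover have "ennreal (R ^ Suc (Suc n)) = ennreal R * ennreal (R ^ Suc n)"
        using R by (simp add: ennreal_mult)
      ultimately show ?thesis
        by (simp add: nn_integral_multc[symmetric] mult.assoc mult.left_commute)
    qed
    have "w i = ennreal (M i j) * ennreal R +
        (\<Sum>n. ennreal (first_entrance I M (Suc (Suc n)) i j) * ennreal (R ^ Suc (Suc n)))"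
      unfolding w_def by (subst suminf_offset[of _ 1]) (simp_all add: add.commute)
    also have "(\<Sum>n. ennreal (first_entrance I M (Suc (Suc n)) i j) * ennreal (R ^ Suc (Suc n))) =
        ennreal R * (\<integral>\<^sup>+\<alpha>. ennreal (M i \<alpha>) * w \<alpha> \<partial>count_space (I - {j}))"
      unfolding step w_def by (simp add: nn_integral_suminf flip: ennreal_suminf_cmult)
    also have "ennreal (M i j) * ennreal R + \<dots> = ennreal R *
      ((\<integral>\<^sup>+\<alpha>. ennreal (M i \<alpha>) * w \<alpha> \<partial>count_space {j}) + (\<integral>\<^sup>+\<alpha>. ennreal (M i \<alpha>) * w \<alpha> \<partial>count_space (I - {j})))"
      by (simp add: nn_integral_count_space_finite wj distrib_left mult.commute)
    also have "\<dots> = ennreal R * (\<integral>\<^sup>+\<alpha>. ennreal (M i \<alpha>) * w \<alpha> \<partial>count_space ({j} \<union> (I - {j})))"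
      by (subst nn_integral_count_space_Un) auto
    also have "{j} \<union> (I - {j}) = I" using j by auto
    finally show ?thesis .
  qed
  with wj show thesis using that by blast
qed

end

section \<open>Preimage sums under the transition matrix\<close>

context leo_markov_map
begin

lemma M_nonneg:
  assumes "i \<in> P" "j \<in> P" shows "0 \<le> M i j"
proof -
  obtain c where "c \<in> j \<inter> G" using ex_generic[OF assms(2)] by blast
  then show ?thesis using generic_fibre(2)[OF assms, of c] G_not_E by simp
qed

lemma M_covers:
  assumes "i \<in> P" "j \<in> P" "M i j \<noteq> 0" shows "j \<subseteq> T ` i"
  using assms(3) by (auto simp: transition_matrix_def split: if_splits)

text \<open>A grid of mesh less than \<open>\<delta>\<close> has a point in the interior of each
  such cell, and disjoint interiors have different grid points.\<close>

lemma finite_long_cells: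
  assumes "\<delta> > 0"
  shows "finite {i\<in>P. \<exists>a b. i = {a..b} \<and> \<delta> \<le> b - a}"
proof -
  let ?S = "{i\<in>P. \<exists>a b. i = {a..b} \<and> \<delta> \<le> b - a}"
  obtain N :: nat where N: "N > 0" "1 / real N < \<delta>"
    using assms by (metis nat_approx_posE zero_less_Suc)
  have "\<exists>k\<le>N. real k / real N \<in> interior i" if "i \<in> ?S" for i
  proof -
    from \<open>i \<in> ?S\<close> obtain a b where i: "i \<in> P" "i = {a..b}" "\<delta> \<le> b - a" by blast
    have ab: "0 \<le> a" "b \<le> 1"
      using P_subset_unit[OF i(1)] i assms by auto
    define k where "k = nat (\<lfloor>a * N\<rfloor> + 1)"
    have k: "real k = of_int \<lfloor>a * N\<rfloor> + 1" using ab by (simp add: k_def)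
    have "a * N < real k" "real k \<le> a * N + 1" unfolding k by linarith+
    moreover have "a * N + 1 < b * N"
    proof -
      have "1 < \<delta> * N" using N by (simp add: field_simps)
      also have "\<dots> \<le> (b - a) * N" using i(3) by (intro mult_right_mono) auto
      finally show ?thesis by (simp add: algebra_simps)
    qed
    ultimately have "a < real k / N" "real k / N < b" using N by (simp_all add: field_simps)
    then have "real k / N \<in> interior i" "real k / N < 1"
      using i(2) ab by (auto simp: interior_atLeastAtMost_real)
    moreover from this have "k \<le> N" using N by (simp add: field_simps)
    ultimately show ?thesis by blast
  qed
  then have "\<exists>k. \<forall>i\<in>?S. k i \<le> N \<and> real (k i) / real N \<in> interior i"
    by (intro bchoice) blast
  then obtain k where k: "k i \<le> N" "real (k i) / real N \<in> interior i" if "i \<in> ?S" for i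
    by blast
  have "inj_on k ?S"
  proof (rule inj_onI)
    fix i j assume ij: "i \<in> ?S" "j \<in> ?S" "k i = k j"
    have "real (k i) / real N \<in> interior i" "real (k i) / real N \<in> interior j"
      using k(2)[OF ij(1)] k(2)[OF ij(2)] ij(3) by simp_all
    moreover have "i \<in> P" "j \<in> P" using ij by simp_all
    ultimately show "i = j" using interior_disjoint[of i j] by blast
  qed
  moreover have "k ` ?S \<subseteq> {..N}" using k(1) by blast
  ultimately show ?thesis by (meson finite_atMost inj_on_finite)
qed

lemma finite_column:
  assumes j: "j \<in> P" shows "finite {i\<in>P. M i j \<noteq> 0}"
proof -
  obtain u v where uv: "u < v" "j = {u..v}" using interval_P[OF j] by metis
  have "uniformly_continuous_on {0..1} T" by (rule compact_uniformly_continuous[OF cont]) simp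
  then obtain \<delta> where \<delta>: "\<delta> > 0"
    "\<And>x y. x \<in> {0..1} \<Longrightarrow> y \<in> {0..1} \<Longrightarrow> dist y x < \<delta> \<Longrightarrow> dist (T y) (T x) < v - u"
    unfolding uniformly_continuous_on_def using uv by (metis diff_gt_0_iff_gt)
  have "{i\<in>P. M i j \<noteq> 0} \<subseteq> {i\<in>P. \<exists>a b. i = {a..b} \<and> \<delta> \<le> b - a}"
  proof clarify
    fix i assume i: "i \<in> P" "M i j \<noteq> 0"
    obtain a b where ab: "0 \<le> a" "b \<le> 1" "i = {a..b}" using interval_P[OF i(1)] by metis
    have "u \<in> T ` i" "v \<in> T ` i" using M_covers[OF i(1) j i(2)] uv by auto
    then obtain x y where xy: "x \<in> i" "y \<in> i" "T x = u" "T y = v" by blast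
    then have "\<not> dist y x < \<delta>" using \<delta>(2)[of x y] ab uv by (auto simp: dist_real_def)
    then have "\<delta> \<le> b - a" using xy ab by (auto simp: dist_real_def abs_if split: if_splits)
    then show "\<exists>a b. i = {a..b} \<and> \<delta> \<le> b - a" using ab by blast
  qed
  then show ?thesis using finite_long_cells[OF \<delta>(1)] by (rule finite_subset)
qed

sublocale column_finite_matrix P M
  by unfold_locales (use M_nonneg finite_column in auto)

lemma sum_over_cells:
  fixes h :: "real set \<Rightarrow> ennreal"
  assumes "z \<in> G" "j \<in> P" "z \<in> j"
  shows "(\<integral>\<^sup>+i. h i * indicator i z \<partial>count_space P) = h j"
proof -
  have "(\<integral>\<^sup>+i. h i * indicator i z \<partial>count_space P) = (\<Sum>i\<in>{j}. h i * indicator i z)"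
  proof (rule nn_integral_count_space')
    fix i assume "i \<in> P" "i \<notin> {j}"
    then have "z \<notin> i" using G_cell_unique[OF assms(1,2), of i] assms(3) by blast
    then show "h i * indicator i z = 0" by simp
  qed (use assms in auto)
  then show ?thesis using assms by simp
qed

text \<open>A generic point lies in exactly one cell, so summing over the cells and then over their
  points visits it once. Common end points of cells and points outside all cells do no harm, as the
  functions vanish off \<open>G\<close>.\<close>

lemma integral_over_cells:
  fixes f :: "real \<Rightarrow> ennreal"
  assumes supp: "\<And>z. z \<notin> G \<Longrightarrow> f z = 0"
    and h: "\<And>z j. z \<in> G \<Longrightarrow> j \<in> P \<Longrightarrow> z \<in> j \<Longrightarrow> h j * f z = g z"
    and g: "\<And>z. z \<notin> G \<Longrightarrow> g z = 0"
  shows "(\<integral>\<^sup>+j. h j * (\<integral>\<^sup>+z. f z \<partial>count_space j) \<partial>count_space P) = (\<integral>\<^sup>+z. g z \<partial>count_space UNIV)"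
proof -
  have "(\<integral>\<^sup>+j. h j * (\<integral>\<^sup>+z. f z \<partial>count_space j) \<partial>count_space P) =
    (\<integral>\<^sup>+j. \<integral>\<^sup>+z. h j * f z * indicator j z \<partial>count_space UNIV \<partial>count_space P)"
    by (intro nn_integral_cong)
      (simp add: nn_integral_count_space_indicator nn_integral_cmult[symmetric] mult.assoc)
  also have "\<dots> = (\<integral>\<^sup>+z. \<integral>\<^sup>+j. h j * f z * indicator j z \<partial>count_space P \<partial>count_space UNIV)"
    by (rule nn_integral_count_space_nn_integral[symmetric]) (auto simp: countable_P)
  also have "\<dots> = (\<integral>\<^sup>+z. g z \<partial>count_space UNIV)"
  proof (rule nn_integral_cong)
    fix z
    show "(\<integral>\<^sup>+j. h j * f z * indicator j z \<partial>count_space P) = g z"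
    proof (cases "z \<in> G")
      case True
      then obtain j where j: "j \<in> P" "z \<in> j" using G_cell interior_subset by (metis subsetD)
      show ?thesis using sum_over_cells[OF True j, of "\<lambda>j. h j * f z"] h[OF True j] by simp
    qed (simp add: supp g)
  qed
  finally show ?thesis .
qed

lemma integral_unit:
  fixes f :: "real \<Rightarrow> ennreal"
  assumes supp: "\<And>z. z \<notin> G \<Longrightarrow> f z = 0"
  shows "(\<integral>\<^sup>+z. f z \<partial>count_space {0..1}) = (\<integral>\<^sup>+j. (\<integral>\<^sup>+z. f z \<partial>count_space j) \<partial>count_space P)"
proof -
  have "(\<integral>\<^sup>+z. f z \<partial>count_space {0..1}) = (\<integral>\<^sup>+z. f z \<partial>count_space UNIV)"
    by (intro nn_integral_count_space_eq) (use supp G_subset in blast)+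
  then show ?thesis using integral_over_cells[of f "\<lambda>_. 1" f] supp by simp
qed

text \<open>Grouping the points \<open>x\<close> by the value \<open>z = T x\<close> leaves the
  fibre sizes, which are \<open>M i j\<close> for generic \<open>z\<close> in \<open>j\<close>. So
  composition with \<open>T\<close> acts on the vector of cell sums as the transition
  matrix.\<close>

lemma transfer:
  fixes f :: "real \<Rightarrow> ennreal"
  assumes i: "i \<in> P" and supp: "\<And>z. z \<notin> G \<Longrightarrow> f z = 0"
  shows "(\<integral>\<^sup>+x. f (T x) \<partial>count_space i) =
    (\<integral>\<^sup>+j. ennreal (M i j) * (\<integral>\<^sup>+z. f z \<partial>count_space j) \<partial>count_space P)"
proof -
  have "ennreal (M i j) * f z = f z * emeasure (count_space UNIV) {x\<in>i. T x = z}"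
    if "z \<in> G" "j \<in> P" "z \<in> j" for z j
    using generic_fibre[OF i that(2,3) G_not_E[OF that(1)]]
    by (simp add: emeasure_count_space_finite ennreal_of_nat_eq_real_of_nat mult.commute)
  then show ?thesis
    unfolding nn_integral_count_space_fibres
    by (intro integral_over_cells[symmetric]) (auto simp: supp)
qed

lemma transfer_funpow:
  fixes f :: "real \<Rightarrow> ennreal"
  assumes i: "i \<in> P" and supp: "\<And>z. z \<notin> G \<Longrightarrow> f z = 0"
  shows "(\<integral>\<^sup>+x. f ((T ^^ Suc n) x) \<partial>count_space i) =
    (\<integral>\<^sup>+j. ennreal (M i j) * (\<integral>\<^sup>+z. f ((T ^^ n) z) \<partial>count_space j) \<partial>count_space P)"
proof -
  \<comment> \<open>The values of \<open>T\<close> off the unit interval are arbitrary, and backward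
    invariance of \<open>G\<close> is available only inside it.\<close>
  let ?g = "\<lambda>z. f ((T ^^ n) z) * indicator {0..1} z"
  have "?g z = 0" if "z \<notin> G" for z
    using that supp G_funpow_backward by (auto simp: indicator_def)
  from transfer[of i ?g, OF i this]
  have "(\<integral>\<^sup>+x. ?g (T x) \<partial>count_space i) =
    (\<integral>\<^sup>+j. ennreal (M i j) * (\<integral>\<^sup>+z. ?g z \<partial>count_space j) \<partial>count_space P)" by simp
  moreover have "(\<integral>\<^sup>+z. ?g z \<partial>count_space j) = (\<integral>\<^sup>+z. f ((T ^^ n) z) \<partial>count_space j)" if "j \<in> P" for j
    using P_subset_unit[OF that] by (intro nn_integral_cong) (auto simp: indicator_def)
  moreover have "(\<integral>\<^sup>+x. ?g (T x) \<partial>count_space i) = (\<integral>\<^sup>+x. f ((T ^^ Suc n) x) \<partial>count_space i)"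
    using P_subset_unit[OF i] in_unit
    by (intro nn_integral_cong) (auto simp: funpow_Suc_right indicator_def simp del: funpow.simps)
  moreover have "(\<integral>\<^sup>+j. ennreal (M i j) * (\<integral>\<^sup>+z. ?g z \<partial>count_space j) \<partial>count_space P) =
    (\<integral>\<^sup>+j. ennreal (M i j) * (\<integral>\<^sup>+z. f ((T ^^ n) z) \<partial>count_space j) \<partial>count_space P)"
    using calculation(2) by (intro nn_integral_cong) simp
  ultimately show ?thesis by (simp only:)
qed

lemma matrix_power_count:
  assumes "i \<in> P" "k \<in> P" "c \<in> k" "c \<in> G"
  shows "ennreal (matrix_power P M n i k) = (\<integral>\<^sup>+x. indicator {c} ((T ^^ n) x) \<partial>count_space i)"
  using assms(1)
proof (induction n arbitrary: i)
  case 0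
  have "c \<in> i \<longleftrightarrow> i = k" using G_cell_unique[OF assms(4) 0 assms(2)] assms(3) by blast
  moreover have "(\<integral>\<^sup>+x. indicator {c} x \<partial>count_space i) = (\<Sum>x\<in>i \<inter> {c}. indicator {c} x)"
    by (rule nn_integral_count_space') auto
  moreover have "i \<inter> {c} = (if i = k then {c} else {})" using calculation(1) by auto
  ultimately show ?case by simp
next
  case (Suc n)
  show ?case
    unfolding ennreal_matrix_power_Suc[OF Suc.prems assms(2)]
    by (subst transfer_funpow[OF Suc.prems])
      (use assms(4) Suc.IH in \<open>auto intro!: nn_integral_cong simp: indicator_def\<close>)
qed


definition base :: "real set \<Rightarrow> real" where "base j = (SOME c. c \<in> j \<inter> G)"

lemma base: "j \<in> P \<Longrightarrow> base j \<in> j" "j \<in> P \<Longrightarrow> base j \<in> G"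
  using someI_ex[OF ex_generic] by (auto simp: base_def)

lemma base_in_iff: "i \<in> P \<Longrightarrow> j \<in> P \<Longrightarrow> base i \<in> j \<longleftrightarrow> i = j"
  using base G_cell_unique by blast

definition point_weight :: "(real set \<Rightarrow> ennreal) \<Rightarrow> real \<Rightarrow> ennreal" where
  "point_weight w z = (\<integral>\<^sup>+j. w j * indicator {base j} z \<partial>count_space P)"

lemma point_weight_base:
  assumes "j \<in> P" shows "point_weight w (base j) = w j"
proof -
  have "point_weight w (base j) = (\<Sum>i\<in>{j}. w i * indicator {base i} (base j))"
    unfolding point_weight_def
  proof (rule nn_integral_count_space')
    fix i assume i: "i \<in> P" "i \<notin> {j}"
    then have "base j \<noteq> base i" using base_in_iff[of i j] base(1)[of j] assms by auto
    then show "w i * indicator {base i} (base j) = 0" by simp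
  qed (use assms in auto)
  then show ?thesis by simp
qed

lemma point_weight_outside:
  assumes "\<And>j. j \<in> P \<Longrightarrow> z \<noteq> base j" shows "point_weight w z = 0"
proof -
  have "point_weight w z = (\<integral>\<^sup>+j. 0 \<partial>count_space P)"
    unfolding point_weight_def using assms by (intro nn_integral_cong) auto
  then show ?thesis by simp
qed

lemma point_weight_supp: "z \<notin> G \<Longrightarrow> point_weight w z = 0"
  using point_weight_outside base(2) by metis

lemma point_weight_cell:
  assumes "j \<in> P" shows "(\<integral>\<^sup>+z. point_weight w z \<partial>count_space j) = w j"
proof -
  have "(\<integral>\<^sup>+z. point_weight w z \<partial>count_space j) = (\<Sum>z\<in>{base j}. point_weight w z)"
  proof (rule nn_integral_count_space')
    fix z assume z: "z \<in> j" "z \<notin> {base j}"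
    show "point_weight w z = 0"
    proof (rule point_weight_outside)
      fix i assume "i \<in> P"
      then show "z \<noteq> base i" using base_in_iff[of i j] z assms by auto
    qed
  qed (use base assms in auto)
  then show ?thesis using point_weight_base[OF assms] by simp
qed

text \<open>Each pullback multiplies the vector of cell masses by the matrix, by
  \<open>transfer_funpow\<close>, and the eigenvector equation cancels the matrix against one factor
  \<open>R\<close>.\<close>

lemma point_weight_funpow:
  assumes eig: "\<And>i. i \<in> P \<Longrightarrow> w i = R * (\<integral>\<^sup>+j. ennreal (M i j) * w j \<partial>count_space P)"
    and i: "i \<in> P"
  shows "R ^ n * (\<integral>\<^sup>+x. point_weight w ((T ^^ n) x) \<partial>count_space i) = w i"
  using i
proof (induction n arbitrary: i)
  case (Suc n)
  have "R ^ Suc n * (\<integral>\<^sup>+x. point_weight w ((T ^^ Suc n) x) \<partial>count_space i) =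
    R * (R ^ n * (\<integral>\<^sup>+j. ennreal (M i j) * (\<integral>\<^sup>+z. point_weight w ((T ^^ n) z) \<partial>count_space j) \<partial>count_space P))"
    by (subst transfer_funpow[OF Suc.prems point_weight_supp]) (simp_all add: mult.assoc)
  also have "\<dots> = R * (\<integral>\<^sup>+j. ennreal (M i j) * (R ^ n * (\<integral>\<^sup>+z. point_weight w ((T ^^ n) z) \<partial>count_space j)) \<partial>count_space P)"
    by (simp add: nn_integral_cmult[symmetric] mult.left_commute)
  also have "\<dots> = R * (\<integral>\<^sup>+j. ennreal (M i j) * w j \<partial>count_space P)"
    using Suc.IH by (auto intro!: arg_cong2[where f = "(*)"] nn_integral_cong)
  also have "\<dots> = w i" using eig[OF Suc.prems] by simp
  finally show ?case .
qed (simp add: point_weight_cell)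

lemma image_funpow_integral_le:
  fixes f :: "real \<Rightarrow> ennreal"
  assumes "(T ^^ n) ` A = {0..1}"
  shows "(\<integral>\<^sup>+z. f z \<partial>count_space {0..1}) \<le> (\<integral>\<^sup>+x. f ((T ^^ n) x) \<partial>count_space A)"
  using nn_integral_count_space_image_le[where f = f and T = "T ^^ n" and A = A] assms by simp

section \<open>The normalized eigenvector\<close>

lemma recurrent_eigenvector:
  assumes rec: "recurrent_matrix P M"
  obtains w :: "real set \<Rightarrow> real" and lam :: real and j0 where
    "1 < lam" "\<And>i. 0 \<le> w i" "(\<integral>\<^sup>+i. ennreal (w i) \<partial>count_space P) = 1"
    "\<And>i. i \<in> P \<Longrightarrow> (\<integral>\<^sup>+j. ennreal (M i j) * ennreal (w j) \<partial>count_space P) = ennreal lam * ennreal (w i)"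
    "j0 \<in> P" "conv_radius (\<lambda>n. matrix_power P M n j0 j0) = ereal (1 / lam)"
proof -
  obtain j0 where j0: "j0 \<in> P" using P_nonempty by blast
  from rec j0 obtain R where R: "conv_radius (\<lambda>n. matrix_power P M n j0 j0) = ereal R"
    and sum1: "(\<lambda>n. first_entrance P M (Suc n) j0 j0 * R ^ Suc n) sums 1"
    unfolding recurrent_matrix_def by blast
  have "0 \<le> ereal R" unfolding R[symmetric] by (rule conv_radius_nonneg)
  then have R0: "0 \<le> R" by simp
  moreover have "R \<noteq> 0"
  proof
    assume "R = 0"
    then have "(\<lambda>n. 0::real) sums 1" using sum1 by simp
    then show False using sums_unique2[OF sums_zero, of "1::real"] by simp
  qed
  ultimately have Rpos: "0 < R" by simp
  obtain w0 where w0: "w0 j0 = 1"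
    "\<And>i. i \<in> P \<Longrightarrow> w0 i = ennreal R * (\<integral>\<^sup>+j. ennreal (M i j) * w0 j \<partial>count_space P)"
    using first_entrance_eigenvector[OF j0 R0 sum1] by metis
  define W where "W = (\<integral>\<^sup>+i. w0 i \<partial>count_space P)"
  have total: "(\<integral>\<^sup>+z. point_weight w0 z \<partial>count_space {0..1}) = W"
    unfolding W_def by (subst integral_unit[OF point_weight_supp])
      (auto intro!: nn_integral_cong simp: point_weight_cell)
  have W1: "1 \<le> W"
  proof -
    have "w0 j0 = (\<integral>\<^sup>+i. w0 i \<partial>count_space {j0})" by (simp add: nn_integral_count_space_finite)
    also have "\<dots> \<le> W" unfolding W_def by (rule nn_integral_count_space_mono) (use j0 in auto)
    finally show ?thesis by (simp add: w0(1))
  qed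
  obtain a b where ab: "0 \<le> a" "a < b" "b \<le> 1" "j0 = {a..b}" using interval_P[OF j0] by metis
  define m where "m = (a + b) / 2"
  have m: "a < m" "m < b" using ab by (auto simp: m_def)
  obtain q1 where q1: "\<And>n. n \<ge> q1 \<Longrightarrow> (T ^^ n) ` {a<..<m} = {0..1}"
    by (rule eventually_onto[of "{a<..<m}"]) (use openin_Ioo[of a m] ab m in auto)
  obtain q2 where q2: "\<And>n. n \<ge> q2 \<Longrightarrow> (T ^^ n) ` {m<..<b} = {0..1}"
    by (rule eventually_onto[of "{m<..<b}"]) (use openin_Ioo[of m b] ab m in auto)
  define q where "q = max q1 q2"
  \<comment> \<open>Both halves of the cell \<open>j0\<close> cover the unit interval at time
    \<open>q\<close>, so the pullback to the cell has at least twice the total mass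
    \<open>W\<close>, while its mass scaled by \<open>R ^ q\<close> is \<open>w0 j0 = 1\<close>. The
    resulting \<open>R ^ q * (W + W) \<le> 1\<close> shows that \<open>W\<close> is finite and, as
    \<open>1 \<le> W\<close>, that \<open>R < 1\<close>.\<close>
  have "W + W \<le> (\<integral>\<^sup>+x. point_weight w0 ((T ^^ q) x) \<partial>count_space {a<..<m}) +
      (\<integral>\<^sup>+x. point_weight w0 ((T ^^ q) x) \<partial>count_space {m<..<b})"
    unfolding total[symmetric]
    by (intro add_mono image_funpow_integral_le q1 q2) (auto simp: q_def)
  also have "\<dots> = (\<integral>\<^sup>+x. point_weight w0 ((T ^^ q) x) \<partial>count_space ({a<..<m} \<union> {m<..<b}))"
    by (rule nn_integral_count_space_Un[symmetric]) auto
  also have "\<dots> \<le> (\<integral>\<^sup>+x. point_weight w0 ((T ^^ q) x) \<partial>count_space j0)"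
    by (rule nn_integral_count_space_mono) (use ab m in auto)
  finally have "ennreal R ^ q * (W + W) \<le> ennreal R ^ q * (\<integral>\<^sup>+x. point_weight w0 ((T ^^ q) x) \<partial>count_space j0)"
    by (rule mult_left_mono) simp
  also have "\<dots> = 1"
    using point_weight_funpow[OF w0(2) j0, of q] w0(1) by simp
  finally have le1: "ennreal (R ^ q) * (W + W) \<le> 1" using R0 by (simp add: ennreal_power)
  have Wfin: "W \<noteq> top"
  proof
    assume "W = top"
    then have "ennreal (R ^ q) * (W + W) = top" using Rpos by (simp add: ennreal_mult_eq_top_iff)
    then show False using le1 by (simp add: top_unique)
  qed
  define \<omega> where "\<omega> = enn2real W"
  have W\<omega>: "W = ennreal \<omega>" using Wfin by (simp add: \<omega>_def ennreal_enn2real_if)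
  have \<omega>1: "1 \<le> \<omega>" using W1 unfolding W\<omega> by simp
  have "R < 1"
  proof (rule ccontr)
    assume "\<not> R < 1"
    then have "1 \<le> R ^ q" by simp
    then have "1 * (1 + 1) \<le> R ^ q * (\<omega> + \<omega>)" using \<omega>1 by (intro mult_mono add_mono) auto
    moreover have "ennreal (R ^ q * (\<omega> + \<omega>)) \<le> ennreal 1"
    proof -
      have "ennreal (R ^ q * (\<omega> + \<omega>)) = ennreal (R ^ q) * ennreal (\<omega> + \<omega>)"
        using R0 \<omega>1 by (intro ennreal_mult) auto
      also have "ennreal (\<omega> + \<omega>) = ennreal \<omega> + ennreal \<omega>"
        using \<omega>1 by (intro ennreal_plus) auto
      finally show ?thesis using le1 unfolding W\<omega> by (simp only: ennreal_1)
    qed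
    ultimately show False by (simp add: ennreal_le_1)
  qed
  define lam where "lam = 1 / R"
  define w where "w i = enn2real (w0 i) / \<omega>" for i
  have w0_le: "w0 i \<le> W" if "i \<in> P" for i
  proof -
    have "w0 i = (\<integral>\<^sup>+i. w0 i \<partial>count_space {i})" by (simp add: nn_integral_count_space_finite)
    also have "\<dots> \<le> W" unfolding W_def by (rule nn_integral_count_space_mono) (use that in auto)
    finally show ?thesis .
  qed
  have w: "ennreal (w i) = w0 i * ennreal (1 / \<omega>)" if "i \<in> P" for i
  proof -
    have "w0 i \<noteq> top" using w0_le[OF that] Wfin by (auto simp: top_unique)
    then have "w0 i = ennreal (enn2real (w0 i))" by (simp add: ennreal_enn2real_if)
    moreover have "w i = enn2real (w0 i) * (1 / \<omega>)" by (simp add: w_def)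
    ultimately show ?thesis using \<omega>1 by (metis ennreal_mult enn2real_nonneg le_numeral_extra(4) order_trans zero_le_divide_1_iff zero_le_one)
  qed
  show thesis
  proof (rule that[of lam w j0])
    show "1 < lam" using Rpos \<open>R < 1\<close> by (simp add: lam_def)
    show "0 \<le> w i" for i using \<omega>1 by (simp add: w_def)
    have "(\<integral>\<^sup>+i. ennreal (w i) \<partial>count_space P) = (\<integral>\<^sup>+i. w0 i * ennreal (1 / \<omega>) \<partial>count_space P)"
      by (intro nn_integral_cong) (simp add: w)
    also have "\<dots> = W * ennreal (1 / \<omega>)" by (simp add: nn_integral_multc W_def)
    also have "\<dots> = 1" unfolding W\<omega> using \<omega>1 by (simp add: ennreal_mult[symmetric])
    finally show "(\<integral>\<^sup>+i. ennreal (w i) \<partial>count_space P) = 1" .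
    show "(\<integral>\<^sup>+j. ennreal (M i j) * ennreal (w j) \<partial>count_space P) = ennreal lam * ennreal (w i)"
      if i: "i \<in> P" for i
    proof -
      have "(\<integral>\<^sup>+j. ennreal (M i j) * ennreal (w j) \<partial>count_space P) =
        (\<integral>\<^sup>+j. ennreal (M i j) * w0 j * ennreal (1 / \<omega>) \<partial>count_space P)"
        by (intro nn_integral_cong) (simp add: w mult.assoc)
      also have "\<dots> = (\<integral>\<^sup>+j. ennreal (M i j) * w0 j \<partial>count_space P) * ennreal (1 / \<omega>)"
        by (simp add: nn_integral_multc)
      also have "(\<integral>\<^sup>+j. ennreal (M i j) * w0 j \<partial>count_space P) = ennreal lam * w0 i"
      proof -
        have "ennreal lam * ennreal R = 1" using Rpos by (simp add: lam_def ennreal_mult[symmetric])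
        then show ?thesis by (subst w0(2)[OF i]) (simp add: mult.assoc[symmetric])
      qed
      finally show ?thesis using w[OF i] by (simp add: mult.assoc)
    qed
    show "j0 \<in> P" by fact
    show "conv_radius (\<lambda>n. matrix_power P M n j0 j0) = ereal (1 / lam)" using R by (simp add: lam_def)
  qed
qed

end

section \<open>Contents from pulled-back point masses\<close>

locale weighted_markov_map = leo_markov_map +
  fixes w :: "real set \<Rightarrow> real" and lam :: real
  assumes lam_gt_1: "1 < lam" and w_nonneg: "0 \<le> w i"
    and w_sum: "(\<integral>\<^sup>+i. ennreal (w i) \<partial>count_space P) = 1"
    and eigen: "i \<in> P \<Longrightarrow>
      (\<integral>\<^sup>+j. ennreal (M i j) * ennreal (w j) \<partial>count_space P) = ennreal lam * ennreal (w i)"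
begin

abbreviation u :: "real \<Rightarrow> ennreal" where "u \<equiv> point_weight (\<lambda>j. ennreal (w j))"

text \<open>
  The mass of the cell \<open>j\<close> is put on one generic point of \<open>j\<close> and pulled back by the
  \<open>n\<close>-th iterate.
\<close>

definition emu :: "nat \<Rightarrow> real set \<Rightarrow> ennreal" where
  "emu n A = ennreal ((1 / lam) ^ n) * (\<integral>\<^sup>+x. u ((T ^^ n) x) \<partial>count_space A)"

lemma lam_pos: "0 < lam" using lam_gt_1 by simp

lemma emu_Un: "A \<inter> B = {} \<Longrightarrow> emu n (A \<union> B) = emu n A + emu n B"
  by (simp add: emu_def nn_integral_count_space_Un distrib_left)

lemma emu_mono: "A \<subseteq> B \<Longrightarrow> emu n A \<le> emu n B"
  unfolding emu_def by (intro mult_left_mono nn_integral_count_space_mono) auto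

lemma emu_cell:
  assumes "i \<in> P" shows "emu n i = ennreal (w i)"
proof -
  have "ennreal (w i) = ennreal (1 / lam) * (\<integral>\<^sup>+j. ennreal (M i j) * ennreal (w j) \<partial>count_space P)"
    if "i \<in> P" for i
  proof -
    have "ennreal (1 / lam) * ennreal lam = 1" using lam_gt_1 by (simp add: ennreal_mult[symmetric])
    then show ?thesis using eigen[OF that] by (simp add: mult.assoc[symmetric])
  qed
  from point_weight_funpow[OF this assms, of n] show ?thesis
    using lam_gt_1 by (simp add: emu_def ennreal_power)
qed

text \<open>The point masses sit on generic points, and so do their preimages in the unit interval,
  by backward invariance of \<open>G\<close>.\<close>

lemma emu_cong:
  assumes "A \<subseteq> {0..1}" "B \<subseteq> {0..1}" "A \<inter> G = B \<inter> G" shows "emu n A = emu n B"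
proof -
  have zero: "u ((T ^^ n) x) = 0" if "x \<in> {0..1}" "x \<notin> G" for x
    using that G_funpow_backward point_weight_supp by blast
  have "(\<integral>\<^sup>+x. u ((T ^^ n) x) \<partial>count_space A) = (\<integral>\<^sup>+x. u ((T ^^ n) x) \<partial>count_space B)"
    by (rule nn_integral_count_space_eq) (use zero assms in blast)+
  then show ?thesis by (simp add: emu_def)
qed

lemma emu_unit: "emu n {0..1} = 1"
proof -
  let ?f = "\<lambda>x. u ((T ^^ n) x) * indicator {0..1} x"
  have "?f z = 0" if "z \<notin> G" for z
    using that G_funpow_backward point_weight_supp by (auto simp: indicator_def)
  then have "(\<integral>\<^sup>+x. ?f x \<partial>count_space {0..1}) = (\<integral>\<^sup>+j. (\<integral>\<^sup>+z. ?f z \<partial>count_space j) \<partial>count_space P)"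
    by (rule integral_unit)
  moreover have "(\<integral>\<^sup>+z. ?f z \<partial>count_space j) = (\<integral>\<^sup>+z. u ((T ^^ n) z) \<partial>count_space j)" if "j \<in> P" for j
    using P_subset_unit[OF that] by (intro nn_integral_cong) (auto simp: indicator_def)
  moreover have "(\<integral>\<^sup>+x. ?f x \<partial>count_space {0..1}) = (\<integral>\<^sup>+x. u ((T ^^ n) x) \<partial>count_space {0..1})"
    by (intro nn_integral_cong) auto
  ultimately have "emu n {0..1} = ennreal ((1 / lam) ^ n) * (\<integral>\<^sup>+j. (\<integral>\<^sup>+z. u ((T ^^ n) z) \<partial>count_space j) \<partial>count_space P)"
    unfolding emu_def by (metis (mono_tags, lifting) nn_integral_cong space_count_space)
  also have "\<dots> = (\<integral>\<^sup>+j. emu n j \<partial>count_space P)"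
    by (simp add: emu_def nn_integral_cmult)
  also have "\<dots> = 1" unfolding w_sum[symmetric] by (intro nn_integral_cong) (simp add: emu_cell)
  finally show ?thesis .
qed

lemma emu_Suc:
  assumes "A \<subseteq> {0..1}"
  shows "ennreal lam * emu (Suc n) A = ennreal ((1 / lam) ^ n) * (\<integral>\<^sup>+x. u ((T ^^ n) (T x)) \<partial>count_space A)"
proof -
  have "ennreal lam * ennreal ((1 / lam) ^ Suc n) = ennreal ((1 / lam) ^ n)"
    using lam_gt_1 by (simp add: ennreal_mult[symmetric])
  then show ?thesis
    unfolding emu_def by (simp add: mult.assoc[symmetric] funpow_Suc_right del: funpow.simps power_Suc)
qed

lemma emu_image_le:
  assumes "A \<subseteq> {0..1}" shows "emu n (T ` A) \<le> ennreal lam * emu (Suc n) A"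
  unfolding emu_Suc[OF assms] unfolding emu_def
  by (intro mult_left_mono nn_integral_count_space_image_le) simp

lemma emu_image_inj:
  assumes "A \<subseteq> {0..1}" "inj_on T A" shows "emu n (T ` A) = ennreal lam * emu (Suc n) A"
  unfolding emu_Suc[OF assms(1)] unfolding emu_def
  by (simp add: nn_integral_count_space_image[OF assms(2)])

text \<open>No point mass exceeds the total mass 1, so only the scaling factor remains. The bound
  tends to 0, which leaves no atoms in the limit.\<close>

lemma emu_singleton_le: "emu n {x} \<le> ennreal ((1 / lam) ^ n)"
proof -
  have "u z \<le> 1" for z
  proof (cases "\<exists>j\<in>P. z = base j")
    case True
    then obtain j where j: "j \<in> P" "z = base j" by blast
    then have "u z = (\<integral>\<^sup>+i. ennreal (w i) \<partial>count_space {j})"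
      by (simp add: point_weight_base nn_integral_count_space_finite)
    also have "\<dots> \<le> (\<integral>\<^sup>+i. ennreal (w i) \<partial>count_space P)"
      by (rule nn_integral_count_space_mono) (use j in auto)
    finally show ?thesis by (simp add: w_sum)
  next
    case False
    then show ?thesis using point_weight_outside[of z "\<lambda>j. ennreal (w j)"] by auto
  qed
  from mult_left_mono[OF this] show ?thesis
    unfolding emu_def by (simp add: nn_integral_count_space_finite)
qed

definition mu :: "nat \<Rightarrow> real set \<Rightarrow> real" where "mu n A = enn2real (emu n A)"

lemma emu_le_1: "A \<subseteq> {0..1} \<Longrightarrow> emu n A \<le> 1"
  using emu_mono[of A "{0..1}" n] by (simp add: emu_unit)

lemma emu_eq: "A \<subseteq> {0..1} \<Longrightarrow> emu n A = ennreal (mu n A)"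
  using emu_le_1[of A n] by (simp add: mu_def ennreal_enn2real_if) (metis ennreal_one_less_top not_le)

lemma mu_nonneg: "0 \<le> mu n A" by (simp add: mu_def)

lemma mu_le_1: "A \<subseteq> {0..1} \<Longrightarrow> mu n A \<le> 1"
  using emu_le_1[of A n] emu_eq[of A n] by simp

lemma mu_Un:
  assumes "A \<subseteq> {0..1}" "B \<subseteq> {0..1}" "A \<inter> B = {}"
  shows "mu n (A \<union> B) = mu n A + mu n B"
proof -
  have "ennreal (mu n (A \<union> B)) = ennreal (mu n A + mu n B)"
    using assms emu_Un[OF assms(3), of n] by (simp add: emu_eq[symmetric] ennreal_plus mu_nonneg)
  then show ?thesis by (subst (asm) ennreal_inj) (auto simp: mu_nonneg)
qed

lemma mu_mono: "A \<subseteq> B \<Longrightarrow> B \<subseteq> {0..1} \<Longrightarrow> mu n A \<le> mu n B"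
  using emu_mono[of A B n] emu_eq[of A n] emu_eq[of B n] mu_nonneg[of n B] by simp

lemma mu_unit: "mu n {0..1} = 1" by (simp add: mu_def emu_unit)

lemma mu_interior_cell:
  assumes "i \<in> P" shows "mu n (interior i) = w i"
proof -
  have "emu n (interior i) = emu n i"
    using not_E_in_interior[OF assms] G_not_E P_subset_unit[OF assms] interior_subset[of i]
    by (intro emu_cong) blast+
  then show ?thesis using emu_cell[OF assms, of n] w_nonneg by (simp add: mu_def)
qed

lemma mu_image_le:
  assumes "A \<subseteq> {0..1}" shows "mu n (T ` A) \<le> lam * mu (Suc n) A"
proof -
  have "T ` A \<subseteq> {0..1}" using assms in_unit by blast
  then have "ennreal (mu n (T ` A)) \<le> ennreal (lam * mu (Suc n) A)"
    using emu_image_le[OF assms, of n] assms lam_pos by (simp add: emu_eq ennreal_mult mu_nonneg)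
  then show ?thesis using lam_pos mu_nonneg by simp
qed

lemma mu_image_inj:
  assumes "A \<subseteq> {0..1}" "inj_on T A" shows "mu n (T ` A) = lam * mu (Suc n) A"
proof -
  have "T ` A \<subseteq> {0..1}" using assms in_unit by blast
  then have "ennreal (mu n (T ` A)) = ennreal (lam * mu (Suc n) A)"
    using emu_image_inj[OF assms, of n] assms lam_pos by (simp add: emu_eq ennreal_mult mu_nonneg)
  then show ?thesis using lam_pos mu_nonneg by simp
qed

lemma mu_singleton_le: "x \<in> {0..1} \<Longrightarrow> mu n {x} \<le> (1 / lam) ^ n"
  using emu_singleton_le[of n x] emu_eq[of "{x}" n] lam_pos by simp

lemma mu_cells_add:
  assumes "finite F" "F \<subseteq> P" "A \<subseteq> {0..1}" "\<And>i. i \<in> F \<Longrightarrow> A \<inter> interior i = {}"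
  shows "mu n (A \<union> (\<Union>i\<in>F. interior i)) = mu n A + (\<Sum>i\<in>F. w i)"
  using assms
proof (induction F rule: finite_induct)
  case (insert j F)
  have int: "interior i \<subseteq> {0..1}" if "i \<in> P" for i
    using P_subset_unit[OF that] interior_subset[of i] by blast
  have "mu n ((A \<union> (\<Union>i\<in>F. interior i)) \<union> interior j) = mu n (A \<union> (\<Union>i\<in>F. interior i)) + mu n (interior j)"
  proof (rule mu_Un)
    show "interior j \<subseteq> {0..1}" using insert.prems int by blast
    have "(\<Union>i\<in>F. interior i) \<subseteq> {0..1}"
      by (rule UN_least, rule int) (use insert.prems(1) in auto)
    with insert.prems(2) show "A \<union> (\<Union>i\<in>F. interior i) \<subseteq> {0..1}" by (rule Un_least)
    have "interior i \<inter> interior j = {}" if "i \<in> F" for i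
      using interior_disjoint[of i j] that insert by blast
    then show "(A \<union> (\<Union>i\<in>F. interior i)) \<inter> interior j = {}" using insert.prems(3)[of j] by blast
  qed
  moreover have "A \<union> (\<Union>i\<in>insert j F. interior i) = (A \<union> (\<Union>i\<in>F. interior i)) \<union> interior j" by blast
  ultimately show ?case using insert mu_interior_cell[of j n] by simp
qed simp

lemma w_sum_approx:
  assumes "0 < \<epsilon>"
  obtains F where "finite F" "F \<subseteq> P" "1 - \<epsilon> < (\<Sum>i\<in>F. w i)"
\<comment> \<open>A partition that witnesses recurrence may be finite.\<close>
proof (cases "finite P")
  case True
  then have "ennreal (\<Sum>i\<in>P. w i) = ennreal 1"
    using w_sum by (simp add: nn_integral_count_space_finite w_nonneg sum_ennreal)
  then have "(\<Sum>i\<in>P. w i) = 1" using w_nonneg by (subst (asm) ennreal_inj) (auto intro: sum_nonneg)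
  then show thesis using that[of P] True assms by simp
next
  case False
  define e where "e = from_nat_into P"
  have e: "bij_betw e UNIV P"
    unfolding e_def by (rule bij_betw_from_nat_into[OF countable_P False])
  have "(\<Sum>n. ennreal (w (e n))) = 1"
    using w_sum nn_integral_bij_count_space[OF e, of "\<lambda>i. ennreal (w i)"]
    by (simp add: nn_integral_count_space_nat)
  then have "(\<lambda>n. ennreal (w (e n))) sums ennreal 1" by (metis ennreal_1 summableI summable_sums)
  then have "(\<lambda>n. w (e n)) sums 1" by (subst (asm) sums_ennreal) (simp_all add: w_nonneg)
  then have "(\<lambda>n. \<Sum>k<n. w (e k)) \<longlonglongrightarrow> 1" by (simp add: sums_def)
  then have "eventually (\<lambda>n. 1 - \<epsilon> < (\<Sum>k<n. w (e k))) sequentially"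
    by (rule order_tendstoD(1)) (use assms in simp)
  then obtain n where n: "1 - \<epsilon> < (\<Sum>k<n. w (e k))"
    using eventually_happens'[OF sequentially_bot] by blast
  have inj: "inj_on e {..<n}" using e by (auto simp: bij_betw_def intro: inj_on_subset)
  have "e ` {..<n} \<subseteq> P" using e by (auto simp: bij_betw_def)
  then show thesis using that[of "e ` {..<n}"] n by (simp add: sum.reindex[OF inj])
qed

end

section \<open>One-sided neighbourhoods and the conformal content\<close>

text \<open>Points of the segment that tend to \<open>x\<close> fall infinitely often into one of
  the finitely many pieces. Being closed and convex, this piece contains \<open>x\<close> and an
  initial part of the segment.\<close>

lemma finite_cover_segment:
  fixes x y :: real
  assumes "finite Q" "closed_segment x y \<subseteq> \<Union>Q" "x \<noteq> y"
    and K: "\<And>K. K \<in> Q \<Longrightarrow> closed K \<and> convex K"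
  obtains K z where "K \<in> Q" "closed_segment x z \<subseteq> K" "z \<in> closed_segment x y" "z \<noteq> x"
proof -
  define f where "f n = x + inverse (real (Suc n)) * (y - x)" for n
  have f_seg: "f n \<in> closed_segment x y" for n
    unfolding f_def in_segment
    by (rule exI[of _ "inverse (real (Suc n))"]) (auto simp: algebra_simps inverse_le_1_iff simp del: of_nat_Suc)
  have f_ne: "f n \<noteq> x" for n using assms(3) by (simp add: f_def)
  have f_lim: "f \<longlonglongrightarrow> x"
    using tendsto_add[OF tendsto_const tendsto_mult_right[OF LIMSEQ_inverse_real_of_nat], of x "y - x"]
    unfolding f_def[abs_def] by simp
  have "\<exists>K\<in>Q. infinite {n. f n \<in> K}"
  proof (rule ccontr)
    assume "\<not> ?thesis"
    then have "finite (\<Union>K\<in>Q. {n. f n \<in> K})" using assms(1) by blast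
    moreover have "(\<Union>K\<in>Q. {n. f n \<in> K}) = UNIV" using f_seg assms(2) by blast
    ultimately show False by simp
  qed
  then obtain K where KQ: "K \<in> Q" and inf: "infinite {n. f n \<in> K}" by blast
  have "x \<in> K"
  proof (rule ccontr)
    assume "x \<notin> K"
    then have "eventually (\<lambda>n. f n \<in> - K) sequentially"
      using topological_tendstoD[OF f_lim, of "- K"] K[OF KQ] by (simp add: open_Compl)
    then obtain N where "\<And>n. n \<ge> N \<Longrightarrow> f n \<notin> K" by (auto simp: eventually_sequentially)
    then have "{n. f n \<in> K} \<subseteq> {..<N}" by (metis (no_types, lifting) lessThan_iff mem_Collect_eq not_le subsetI)
    then show False using inf finite_subset by blast
  qed
  moreover obtain n where "f n \<in> K" using inf by (metis (mono_tags, lifting) Collect_empty_eq finite.emptyI)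
  ultimately have "closed_segment x (f n) \<subseteq> K" using K[OF KQ] closed_segment_subset by blast
  then show thesis using that[OF KQ _ f_seg f_ne] by blast
qed

context weighted_markov_map
begin

text \<open>The factor \<open>s\<close> is 1 or -1 and selects the right or the left neighbourhood
  of \<open>x\<close>. The sides are kept apart because \<open>T\<close> may turn at
  \<open>x\<close>, or one side may lie in a cell while cells accumulate on the other.\<close>

definition side :: "real \<Rightarrow> real \<Rightarrow> real \<Rightarrow> real set" where
  "side s x \<eta> = {y\<in>{0..1}. 0 < s * (y - x) \<and> s * (y - x) < \<eta>}"

lemma side_subset: "side s x \<eta> \<subseteq> {0..1}" by (auto simp: side_def)

lemma monotone_segment:
  assumes i: "i \<in> P" and seg: "closed_segment x y \<subseteq> i" "x \<noteq> y"
  obtains z where "z \<in> closed_segment x y" "z \<noteq> x"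
    "monotone_map_on (closed_segment x z) T" "inj_on T (closed_segment x z)"
proof -
  obtain Q where Q: "finite Q" "\<Union>Q = i"
    "\<And>K. K \<in> Q \<Longrightarrow> \<exists>u v. u < v \<and> K = {u..v} \<and> monotone_map_on K T \<and> inj_on T K"
    using monotone_pieces[OF i] by metis
  have "closed K \<and> convex K" if "K \<in> Q" for K using Q(3)[OF that] by auto
  then obtain K z where K: "K \<in> Q" "closed_segment x z \<subseteq> K" "z \<in> closed_segment x y" "z \<noteq> x"
    using finite_cover_segment[OF Q(1) _ seg(2)] seg(1) Q(2) by metis
  then show thesis
    using that[OF K(3,4)] Q(3)[OF K(1)] monotone_map_on_subset inj_on_subset by metis
qed

text \<open>If \<open>x\<close> is an end point of a monotone piece on the given side, the bound at \<open>T x\<close> is pulled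
  back and improves by the factor \<open>lam\<close>. Otherwise the cells accumulate at \<open>x\<close>, and all but an
  amount \<open>\<epsilon>\<close> of the mass is in finitely many cells away from \<open>x\<close>.\<close>

lemma small_sides:
  assumes "0 < \<epsilon>" "\<bar>s\<bar> = 1" "x \<in> {0..1}"
  shows "\<exists>\<eta>>0. \<forall>k\<ge>m. mu k (side s x \<eta>) \<le> \<epsilon> + (1 / lam) ^ m"
  using assms(2,3)
proof (induction m arbitrary: s x)
  case 0
  have "mu k (side s x 1) \<le> \<epsilon> + (1 / lam) ^ 0" for k
    using mu_le_1[OF side_subset, of k s x 1] assms(1) by simp
  then show ?case by (intro exI[of _ 1]) simp
next
  case (Suc m)
  show ?case
  proof (cases "\<exists>i\<in>P. \<exists>y. 0 < s * (y - x) \<and> closed_segment x y \<subseteq> i")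
    case True
    then obtain i y where y: "i \<in> P" "0 < s * (y - x)" "closed_segment x y \<subseteq> i" by blast
    then have "x \<noteq> y" by auto
    then obtain z where z: "z \<in> closed_segment x y" "z \<noteq> x"
      "monotone_map_on (closed_segment x z) T" "inj_on T (closed_segment x z)"
      using monotone_segment[OF y(1,3)] by metis
    have s: "s = 1 \<or> s = -1" using Suc.prems(1) by auto
    have sz: "0 < s * (z - x)"
      using s y(2) z(1,2) by (auto simp: closed_segment_eq_real_ivl split: if_splits)
    have sub: "closed_segment x z \<subseteq> {0..1}"
      using y(3) P_subset_unit[OF y(1)] z(1) subset_closed_segment by (metis ends_in_segment(1) order_trans)
    \<comment> \<open>The sign \<open>t\<close> names the side of \<open>T x\<close> into which
      \<open>T\<close> carries the side \<open>s\<close> of \<open>x\<close>.\<close>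
    have "\<exists>t. \<bar>t\<bar> = 1 \<and> (\<forall>v\<in>closed_segment x z. 0 < s * (v - x) \<longrightarrow> 0 < t * (T v - T x))"
    proof (rule inj_monotone_cases[OF z(3,4)])
      assume *: "\<And>a b. a \<in> closed_segment x z \<Longrightarrow> b \<in> closed_segment x z \<Longrightarrow> a < b \<Longrightarrow> T a < T b"
      have "0 < s * (T v - T x)" if "v \<in> closed_segment x z" "0 < s * (v - x)" for v
        using s *[of x v] *[of v x] that by auto
      then show ?thesis using Suc.prems(1) by blast
    next
      assume *: "\<And>a b. a \<in> closed_segment x z \<Longrightarrow> b \<in> closed_segment x z \<Longrightarrow> a < b \<Longrightarrow> T b < T a"
      have "0 < (- s) * (T v - T x)" if "v \<in> closed_segment x z" "0 < s * (v - x)" for v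
        using s *[of x v] *[of v x] that by auto
      then show ?thesis using Suc.prems(1) by (metis abs_minus)
    qed
    then obtain t where t: "\<bar>t\<bar> = 1"
      "\<And>v. v \<in> closed_segment x z \<Longrightarrow> 0 < s * (v - x) \<Longrightarrow> 0 < t * (T v - T x)" by blast
    obtain \<eta>' where \<eta>': "\<eta>' > 0" "\<And>k. k \<ge> m \<Longrightarrow> mu k (side t (T x) \<eta>') \<le> \<epsilon> + (1 / lam) ^ m"
      using Suc.IH[OF t(1) in_unit[OF Suc.prems(2)]] by blast
    obtain d where d: "d > 0" "\<And>v. v \<in> {0..1} \<Longrightarrow> dist v x < d \<Longrightarrow> dist (T v) (T x) < \<eta>'"
      using cont Suc.prems(2) \<eta>'(1) unfolding continuous_on_iff by metis
    \<comment> \<open>The first bound serves continuity at \<open>x\<close>, the second keeps the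
      side within the monotone segment.\<close>
    define \<eta> where "\<eta> = min d (s * (z - x))"
    have in_seg: "v \<in> closed_segment x z" if "v \<in> side s x \<eta>" for v
      using that s sz by (auto simp: side_def \<eta>_def closed_segment_eq_real_ivl)
    have T_side: "T ` side s x \<eta> \<subseteq> side t (T x) \<eta>'"
    proof clarify
      fix v assume v: "v \<in> side s x \<eta>"
      then have v': "v \<in> {0..1}" "0 < s * (v - x)" "s * (v - x) < d" by (auto simp: side_def \<eta>_def)
      then have "dist v x < d" using s by (auto simp: dist_real_def)
      then have "\<bar>T v - T x\<bar> < \<eta>'" using d(2) v'(1) by (simp add: dist_real_def)
      then have "t * (T v - T x) < \<eta>'" using t(1) by (auto simp: abs_if split: if_splits)
      then show "T v \<in> side t (T x) \<eta>'"
        using t(2)[OF in_seg[OF v] v'(2)] in_unit[OF v'(1)] by (simp add: side_def)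
    qed
    have inj: "inj_on T (side s x \<eta>)" using z(4) in_seg by (meson inj_on_subset subsetI)
    \<comment> \<open>One application of \<open>T\<close> lowers the index of \<open>mu\<close> by
      one, so a bound at depth \<open>m\<close> is available from index \<open>m\<close> on.
      Dividing by \<open>lam\<close> improves the power, and \<open>\<epsilon>\<close> does not grow
      as \<open>1 < lam\<close>.\<close>
    have "mu k (side s x \<eta>) \<le> \<epsilon> + (1 / lam) ^ Suc m" if k: "k \<ge> Suc m" for k
    proof -
      obtain k' where k': "k = Suc k'" "k' \<ge> m" using k by (cases k) auto
      have "lam * mu k (side s x \<eta>) = mu k' (T ` side s x \<eta>)"
        using mu_image_inj[OF side_subset inj, of k'] k' by simp
      also have "\<dots> \<le> mu k' (side t (T x) \<eta>')" by (rule mu_mono[OF T_side side_subset])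
      also have "\<dots> \<le> \<epsilon> + (1 / lam) ^ m" using \<eta>'(2) k' by blast
      also have "\<dots> \<le> lam * \<epsilon> + (1 / lam) ^ m" using lam_gt_1 assms(1) by simp
      also have "\<dots> = lam * (\<epsilon> + (1 / lam) ^ Suc m)" using lam_pos by (simp add: distrib_left)
      finally show ?thesis using lam_pos by simp
    qed
    moreover have "\<eta> > 0" using d sz by (simp add: \<eta>_def)
    ultimately show ?thesis by blast
  next
    case False
    obtain F where F: "finite F" "F \<subseteq> P" "1 - \<epsilon> < (\<Sum>i\<in>F. w i)" by (rule w_sum_approx[OF assms(1)])
    \<comment> \<open>No cell contains a segment that starts at \<open>x\<close> on this side, so
      the interior of each single cell misses some neighbourhood on it. Over all cells these
      neighbourhoods may shrink to nothing, hence the finite \<open>F\<close>.\<close>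
    have "\<exists>\<eta>>0. side s x \<eta> \<inter> interior i = {}" if i: "i \<in> P" for i
    proof -
      obtain a b where ab: "a < b" "i = {a..b}" using interval_P[OF i] by metis
      have s: "s = 1 \<or> s = -1" using Suc.prems(1) by auto
      then consider "s = 1" "x < a" | "s = 1" "b \<le> x" | "s = 1" "a \<le> x" "x < b"
        | "s = -1" "b < x" | "s = -1" "x \<le> a" | "s = -1" "a < x" "x \<le> b" by linarith
      then show ?thesis
      proof cases
        case 1
        then show ?thesis using ab
          by (intro exI[of _ "a - x"]) (auto simp: side_def interior_atLeastAtMost_real)
      next
        case 2
        then show ?thesis using ab
          by (intro exI[of _ 1]) (auto simp: side_def interior_atLeastAtMost_real)
      next
        case 3
        then have "0 < s * (b - x)" "closed_segment x b \<subseteq> i"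
          using ab by (auto simp: closed_segment_eq_real_ivl)
        then show ?thesis using False i by blast
      next
        case 4
        then show ?thesis using ab
          by (intro exI[of _ "x - b"]) (auto simp: side_def interior_atLeastAtMost_real)
      next
        case 5
        then show ?thesis using ab
          by (intro exI[of _ 1]) (auto simp: side_def interior_atLeastAtMost_real)
      next
        case 6
        then have "0 < s * (a - x)" "closed_segment x a \<subseteq> i"
          using ab by (auto simp: closed_segment_eq_real_ivl)
        then show ?thesis using False i by blast
      qed
    qed
    then obtain h where h: "\<And>i. i \<in> P \<Longrightarrow> h i > 0 \<and> side s x (h i) \<inter> interior i = {}" by metis
    define \<eta> where "\<eta> = Min (insert 1 (h ` F))"
    have \<eta>_pos: "\<eta> > 0" using F h by (auto simp: \<eta>_def)
    have disj: "side s x \<eta> \<inter> interior i = {}" if "i \<in> F" for i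
    proof -
      have "\<eta> \<le> h i" using F(1) that by (simp add: \<eta>_def)
      then have "side s x \<eta> \<subseteq> side s x (h i)" by (auto simp: side_def)
      then show ?thesis using h that F(2) by blast
    qed
    have "mu k (side s x \<eta>) \<le> \<epsilon> + (1 / lam) ^ Suc m" for k
    proof -
      have "side s x \<eta> \<union> (\<Union>i\<in>F. interior i) \<subseteq> {0..1}"
      proof (intro Un_least side_subset UN_least)
        fix i assume "i \<in> F"
        then have "i \<subseteq> {0..1}" using F(2) P_subset_unit by blast
        then show "interior i \<subseteq> {0..1}" using interior_subset by (rule order_trans[rotated])
      qed
      then have "mu k (side s x \<eta>) + (\<Sum>i\<in>F. w i) \<le> 1"
        using mu_cells_add[OF F(1,2) side_subset disj, of k] mu_le_1 by metis
      then have "mu k (side s x \<eta>) \<le> \<epsilon>" using F(3) by simp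
      moreover have "0 \<le> (1 / lam) ^ Suc m" using lam_pos by simp
      ultimately show ?thesis by linarith
    qed
    then show ?thesis using \<eta>_pos by blast
  qed
qed

lemma mu_image_funpow_le:
  assumes "A \<subseteq> {0..1}" shows "mu n ((T ^^ q) ` A) \<le> lam ^ q * mu (n + q) A"
  using assms
proof (induction q arbitrary: A)
  case (Suc q)
  have "T ` A \<subseteq> {0..1}" using Suc.prems in_unit by blast
  then have "mu n ((T ^^ q) ` T ` A) \<le> lam ^ q * mu (n + q) (T ` A)" by (rule Suc.IH)
  also have "\<dots> \<le> lam ^ q * (lam * mu (Suc (n + q)) A)"
    using lam_pos by (intro mult_left_mono mu_image_le Suc.prems) auto
  finally show ?case by (simp add: image_comp funpow_Suc_right algebra_simps del: funpow.simps)
qed simp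

text \<open>
  The relation between \<open>mu n (T ` A)\<close> and \<open>mu (Suc n) A\<close> shifts the index, so a cluster point of
  the sequence \<open>mu n\<close> would not do: a shift-invariant limit is needed. The result is only finitely
  additive, which suffices for its distribution function.
\<close>

lemma conformal_content:
  obtains \<nu> :: "real set \<Rightarrow> real" where
    "\<And>A B. A \<subseteq> {0..1} \<Longrightarrow> B \<subseteq> {0..1} \<Longrightarrow> A \<inter> B = {} \<Longrightarrow> \<nu> (A \<union> B) = \<nu> A + \<nu> B"
    "\<And>A B. A \<subseteq> B \<Longrightarrow> B \<subseteq> {0..1} \<Longrightarrow> \<nu> A \<le> \<nu> B"
    "\<nu> {0..1} = 1"
    "\<And>A. A \<subseteq> {0..1} \<Longrightarrow> \<nu> (T ` A) \<le> lam * \<nu> A"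
    "\<And>A. A \<subseteq> {0..1} \<Longrightarrow> inj_on T A \<Longrightarrow> \<nu> (T ` A) = lam * \<nu> A"
    "\<And>x. x \<in> {0..1} \<Longrightarrow> \<nu> {x} = 0"
    "\<And>x \<epsilon>. x \<in> {0..1} \<Longrightarrow> 0 < \<epsilon> \<Longrightarrow> \<exists>\<eta>>0. \<nu> ({x - \<eta><..<x + \<eta>} \<inter> {0..1}) \<le> \<epsilon>"
    "\<And>a b. 0 \<le> a \<Longrightarrow> a < b \<Longrightarrow> b \<le> 1 \<Longrightarrow> 0 < \<nu> {a<..<b}"
proof -
  obtain L :: "(nat \<Rightarrow> real) \<Rightarrow> real" where
    L_add: "\<And>f g. Bseq f \<Longrightarrow> Bseq g \<Longrightarrow> L (\<lambda>n. f n + g n) = L f + L g" and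
    L_scale: "\<And>c f. Bseq f \<Longrightarrow> L (\<lambda>n. c * f n) = c * L f" and
    L_shift: "\<And>f. Bseq f \<Longrightarrow> L (\<lambda>n. f (Suc n)) = L f" and
    L_mono: "\<And>f g N. Bseq f \<Longrightarrow> Bseq g \<Longrightarrow> (\<And>n. n \<ge> N \<Longrightarrow> f n \<le> g n) \<Longrightarrow> L f \<le> L g" and
    L_const: "\<And>c. L (\<lambda>n. c) = c"
    by (rule banach_limit) blast
  define \<nu> where "\<nu> A = L (\<lambda>n. mu n A)" for A
  have B: "Bseq (\<lambda>n. mu n A)" if "A \<subseteq> {0..1}" for A
    using mu_le_1[OF that] mu_nonneg by (intro BseqI'[of _ 1]) simp
  have Bscale: "Bseq (\<lambda>n. c * f n)" if "Bseq f" for c and f :: "nat \<Rightarrow> real"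
    using that by (intro Bseq_mult) auto
  have Bc: "Bseq (\<lambda>n. c)" for c :: real by simp
  have BS: "Bseq (\<lambda>n. f (Suc n))" if "Bseq f" for f :: "nat \<Rightarrow> real"
    using that by (simp add: Bseq_Suc_iff)
  have add: "\<nu> (A \<union> A') = \<nu> A + \<nu> A'" if "A \<subseteq> {0..1}" "A' \<subseteq> {0..1}" "A \<inter> A' = {}" for A A'
    unfolding \<nu>_def using L_add[OF B[OF that(1)] B[OF that(2)]] by (simp add: mu_Un[OF that])
  have mono: "\<nu> A \<le> \<nu> A'" if "A \<subseteq> A'" "A' \<subseteq> {0..1}" for A A'
    unfolding \<nu>_def by (rule L_mono[OF B B]) (use that mu_mono in auto)
  have le_ev: "\<nu> A \<le> c" if "A \<subseteq> {0..1}" "\<And>n. n \<ge> N \<Longrightarrow> mu n A \<le> c" for A c N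
    using L_mono[OF B[OF that(1)] Bc, of N c] that(2) by (simp add: \<nu>_def L_const)
  have shift: "L (\<lambda>n. lam * mu (Suc n) A) = lam * \<nu> A" if "A \<subseteq> {0..1}" for A
    using L_scale[OF BS[OF B[OF that]], of lam] L_shift[OF B[OF that]] by (simp add: \<nu>_def)
  have T_sub: "T ` A \<subseteq> {0..1}" if "A \<subseteq> {0..1}" for A using that in_unit by blast
  have image: "\<nu> (T ` A) \<le> lam * \<nu> A" if "A \<subseteq> {0..1}" for A
    unfolding shift[OF that, symmetric] unfolding \<nu>_def
    by (rule L_mono[OF B[OF T_sub[OF that]] Bscale[OF BS[OF B[OF that]]], of 0]) (rule mu_image_le[OF that])
  have image_inj: "\<nu> (T ` A) = lam * \<nu> A" if "A \<subseteq> {0..1}" "inj_on T A" for A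
    unfolding shift[OF that(1), symmetric] unfolding \<nu>_def by (simp add: mu_image_inj[OF that])
  have power_small: "\<exists>N. \<forall>n\<ge>N. (1 / lam) ^ n \<le> \<epsilon>" if "0 < \<epsilon>" for \<epsilon>
  proof -
    have "(\<lambda>n. (1 / lam) ^ n) \<longlonglongrightarrow> 0"
      using lam_gt_1 by (intro LIMSEQ_power_zero) simp
    from order_tendstoD(2)[OF this that] show ?thesis
      unfolding eventually_sequentially by (meson less_imp_le)
  qed
  have null: "\<nu> {x} = 0" if "x \<in> {0..1}" for x
  proof (rule antisym)
    show "\<nu> {x} \<le> 0"
    proof (rule field_le_epsilon)
      fix e :: real assume "0 < e"
      then obtain N where "\<And>n. n \<ge> N \<Longrightarrow> (1 / lam) ^ n \<le> e" using power_small by blast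
      then have "\<nu> {x} \<le> e"
        by (intro le_ev[of _ N]) (use mu_singleton_le[OF that] that in \<open>auto intro: order_trans\<close>)
      then show "\<nu> {x} \<le> 0 + e" by simp
    qed
    show "0 \<le> \<nu> {x}"
      using L_mono[OF Bc[of 0] B[of "{x}"], of 0] mu_nonneg that by (simp add: \<nu>_def L_const)
  qed
  have small: "\<exists>\<eta>>0. \<nu> ({x - \<eta><..<x + \<eta>} \<inter> {0..1}) \<le> \<epsilon>" if x: "x \<in> {0..1}" and "0 < \<epsilon>" for x \<epsilon>
  proof -
    \<comment> \<open>Each side contributes \<open>\<epsilon> / 4\<close> and a power that is at
      most \<open>\<epsilon> / 4\<close>; the two sides add up to \<open>\<epsilon>\<close>.\<close>
    have e4: "0 < \<epsilon> / 4" using \<open>0 < \<epsilon>\<close> by simp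
    obtain m where m: "(1 / lam) ^ m \<le> \<epsilon> / 4" using power_small[OF e4] by blast
    obtain h1 where h1: "h1 > 0" "\<And>k. k \<ge> m \<Longrightarrow> mu k (side 1 x h1) \<le> \<epsilon> / 4 + (1 / lam) ^ m"
      using small_sides[OF e4 _ x, of 1 m] by auto
    obtain h2 where h2: "h2 > 0" "\<And>k. k \<ge> m \<Longrightarrow> mu k (side (-1) x h2) \<le> \<epsilon> / 4 + (1 / lam) ^ m"
      using small_sides[OF e4 _ x, of "-1" m] by auto
    have s1: "\<nu> (side 1 x h1) \<le> \<epsilon> / 2"
      by (rule le_ev[OF side_subset, of m]) (use h1(2) m in fastforce)
    have s2: "\<nu> (side (-1) x h2) \<le> \<epsilon> / 2"
      by (rule le_ev[OF side_subset, of m]) (use h2(2) m in fastforce)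
    define \<eta> where "\<eta> = min h1 h2"
    have "{x - \<eta><..<x + \<eta>} \<inter> {0..1} \<subseteq> (side 1 x h1 \<union> side (-1) x h2) \<union> {x}"
      by (auto simp: \<eta>_def side_def)
    then have "\<nu> ({x - \<eta><..<x + \<eta>} \<inter> {0..1}) \<le> \<nu> ((side 1 x h1 \<union> side (-1) x h2) \<union> {x})"
      by (rule mono) (use x side_subset in auto)
    also have "\<dots> = \<nu> (side 1 x h1 \<union> side (-1) x h2) + \<nu> {x}"
      by (rule add) (use x in \<open>auto simp: side_def\<close>)
    also have "\<nu> (side 1 x h1 \<union> side (-1) x h2) = \<nu> (side 1 x h1) + \<nu> (side (-1) x h2)"
      by (rule add) (auto simp: side_def)
    finally have "\<nu> ({x - \<eta><..<x + \<eta>} \<inter> {0..1}) \<le> \<epsilon>" using s1 s2 null[OF x] by simp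
    moreover have "\<eta> > 0" using h1 h2 by (simp add: \<eta>_def)
    ultimately show ?thesis by blast
  qed
  have pos: "0 < \<nu> {a<..<b}" if "0 \<le> a" "a < b" "b \<le> 1" for a b
  proof -
    have "openin (top_of_set {0..1}) {a<..<b}" "{a<..<b} \<noteq> {}"
      using openin_Ioo[of a b] that by auto
    then obtain q where q: "\<And>n. n \<ge> q \<Longrightarrow> (T ^^ n) ` {a<..<b} = {0..1}"
      using eventually_onto by metis
    have sub: "{a<..<b} \<subseteq> {0..1}" using that by auto
    \<comment> \<open>The \<open>q\<close>-th iterate of the interval is everything, so this lower
      bound is the same for all \<open>n \<ge> q\<close> and survives in the limit.\<close>
    have "(1 / lam) ^ q \<le> mu n {a<..<b}" if "n \<ge> q" for n
    proof -
      have "1 \<le> lam ^ q * mu (n - q + q) {a<..<b}"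
        using mu_image_funpow_le[OF sub, of "n - q" q] q[of q] mu_unit by simp
      then show ?thesis using lam_pos that by (simp add: power_divide field_simps)
    qed
    from L_mono[OF Bc B[OF sub] this] have "(1 / lam) ^ q \<le> \<nu> {a<..<b}" by (simp add: \<nu>_def L_const)
    moreover have "0 < (1 / lam) ^ q" using lam_pos by simp
    ultimately show ?thesis by linarith
  qed
  have "\<nu> {0..1} = 1" by (simp add: \<nu>_def mu_unit L_const)
  then show thesis using that[of \<nu>] add mono image image_inj null small pos by blast
qed

text \<open>The function is the distribution function of the content; it is continuous because short
  intervals have small content. The image of [x, y] contains the interval between \<open>T x\<close>
  and \<open>T y\<close> but may fold over itself, hence only an inequality in general. It serves
  the upper bound on the entropy, the equality on monotone intervals the slope.\<close>

lemma linearizing_function: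
  obtains \<psi> :: "real \<Rightarrow> real" where
    "continuous_on {0..1} \<psi>" "\<psi> 0 = 0" "\<psi> 1 = 1"
    "\<And>x y. 0 \<le> x \<Longrightarrow> x < y \<Longrightarrow> y \<le> 1 \<Longrightarrow> \<psi> x < \<psi> y"
    "\<And>x y. x \<in> {0..1} \<Longrightarrow> y \<in> {0..1} \<Longrightarrow> \<bar>\<psi> (T x) - \<psi> (T y)\<bar> \<le> lam * \<bar>\<psi> x - \<psi> y\<bar>"
    "\<And>x y. 0 \<le> x \<Longrightarrow> x \<le> y \<Longrightarrow> y \<le> 1 \<Longrightarrow> monotone_map_on {x..y} T \<Longrightarrow>
      \<bar>\<psi> (T x) - \<psi> (T y)\<bar> = lam * (\<psi> y - \<psi> x)"
proof -
  obtain \<nu> :: "real set \<Rightarrow> real" where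
    add: "\<And>A B. A \<subseteq> {0..1} \<Longrightarrow> B \<subseteq> {0..1} \<Longrightarrow> A \<inter> B = {} \<Longrightarrow> \<nu> (A \<union> B) = \<nu> A + \<nu> B" and
    mono: "\<And>A B. A \<subseteq> B \<Longrightarrow> B \<subseteq> {0..1} \<Longrightarrow> \<nu> A \<le> \<nu> B" and
    unit: "\<nu> {0..1} = 1" and
    image: "\<And>A. A \<subseteq> {0..1} \<Longrightarrow> \<nu> (T ` A) \<le> lam * \<nu> A" and
    image_inj: "\<And>A. A \<subseteq> {0..1} \<Longrightarrow> inj_on T A \<Longrightarrow> \<nu> (T ` A) = lam * \<nu> A" and
    null: "\<And>x. x \<in> {0..1} \<Longrightarrow> \<nu> {x} = 0" and
    small: "\<And>x \<epsilon>. x \<in> {0..1} \<Longrightarrow> 0 < \<epsilon> \<Longrightarrow> \<exists>\<eta>>0. \<nu> ({x - \<eta><..<x + \<eta>} \<inter> {0..1}) \<le> \<epsilon>" and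
    pos: "\<And>a b. 0 \<le> a \<Longrightarrow> a < b \<Longrightarrow> b \<le> 1 \<Longrightarrow> 0 < \<nu> {a<..<b}"
    by (rule conformal_content) blast
  define \<psi> where "\<psi> x = \<nu> {0..x}" for x
  have diff: "\<nu> {a<..b} = \<psi> b - \<psi> a" if "0 \<le> a" "a \<le> b" "b \<le> 1" for a b
  proof -
    have "\<nu> ({0..a} \<union> {a<..b}) = \<nu> {0..a} + \<nu> {a<..b}" by (rule add) (use that in auto)
    moreover have "{0..a} \<union> {a<..b} = {0..b}" using that by auto
    ultimately show ?thesis by (simp add: \<psi>_def)
  qed
  have closed: "\<nu> {a..b} = \<psi> b - \<psi> a" if "0 \<le> a" "a \<le> b" "b \<le> 1" for a b
  proof -
    have "\<nu> ({a} \<union> {a<..b}) = \<nu> {a} + \<nu> {a<..b}" by (rule add) (use that in auto)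
    moreover have "{a} \<union> {a<..b} = {a..b}" using that by auto
    ultimately show ?thesis using null[of a] diff[OF that] that by simp
  qed
  have right_open: "\<nu> {a..<b} = \<psi> b - \<psi> a" if "0 \<le> a" "a \<le> b" "b \<le> 1" for a b
  proof -
    have "\<nu> ({a..<b} \<union> {b}) = \<nu> {a..<b} + \<nu> {b}" by (rule add) (use that in auto)
    moreover have "{a..<b} \<union> {b} = {a..b}" using that by auto
    ultimately show ?thesis using null[of b] closed[OF that] that by simp
  qed
  have less: "\<psi> x < \<psi> y" if "0 \<le> x" "x < y" "y \<le> 1" for x y
  proof -
    have "\<nu> {x<..<y} \<le> \<nu> {x<..y}" by (rule mono) (use that in auto)
    then show ?thesis using pos[OF that] diff[of x y] that by simp
  qed
  have lip_le: "\<bar>\<psi> (T x) - \<psi> (T y)\<bar> \<le> lam * (\<psi> y - \<psi> x)" if "0 \<le> x" "x \<le> y" "y \<le> 1" for x y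
  proof -
    have Txy: "T x \<in> {0..1}" "T y \<in> {0..1}" using in_unit that by auto
    have sub: "{x..y} \<subseteq> {0..1}" using that by auto
    have "is_interval (T ` {x..y})"
      unfolding is_interval_connected_1
      by (intro connected_continuous_image continuous_on_subset[OF cont sub] connected_Icc)
    then have "{min (T x) (T y)..max (T x) (T y)} \<subseteq> T ` {x..y}"
      using mem_is_interval_1_I[of "T ` {x..y}" "min (T x) (T y)" "max (T x) (T y)"] that
      by (auto simp: min_def max_def)
    then have "\<nu> {min (T x) (T y)..max (T x) (T y)} \<le> \<nu> (T ` {x..y})"
      by (rule mono) (use sub in_unit in blast)
    also have "\<dots> \<le> lam * \<nu> {x..y}" by (rule image[OF sub])
    also have "\<nu> {x..y} = \<psi> y - \<psi> x" by (rule closed[OF that])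
    also have "\<nu> {min (T x) (T y)..max (T x) (T y)} = \<psi> (max (T x) (T y)) - \<psi> (min (T x) (T y))"
      by (rule closed) (use Txy in auto)
    also have "\<dots> = \<bar>\<psi> (T x) - \<psi> (T y)\<bar>"
      using less[of "T x" "T y"] less[of "T y" "T x"] Txy
      by (cases "T x" "T y" rule: linorder_cases) (auto simp: min_def max_def)
    finally show ?thesis .
  qed
  have psi_le: "\<psi> x \<le> \<psi> y" if "0 \<le> x" "x \<le> y" "y \<le> 1" for x y
    using less[of x y] that by (cases "x = y") auto
  have lip: "\<bar>\<psi> (T x) - \<psi> (T y)\<bar> \<le> lam * \<bar>\<psi> x - \<psi> y\<bar>" if "x \<in> {0..1}" "y \<in> {0..1}" for x y
  proof (cases "x \<le> y")
    case True
    then show ?thesis using lip_le[of x y] psi_le[of x y] that by simp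
  next
    case False
    then show ?thesis using lip_le[of y x] psi_le[of y x] that by (simp add: abs_minus_commute)
  qed
  have slope: "\<bar>\<psi> (T x) - \<psi> (T y)\<bar> = lam * (\<psi> y - \<psi> x)"
    if xy: "0 \<le> x" "x \<le> y" "y \<le> 1" and m: "monotone_map_on {x..y} T" for x y
  proof -
    have sub: "{x..y} \<subseteq> {0..1}" using xy by auto
    have inj: "inj_on T {x..y}" using monotone_inj[OF _ sub m] by (simp add: is_interval_cc)
    have Txy: "T x \<in> {0..1}" "T y \<in> {0..1}" using in_unit xy by auto
    have "inj_on T {x<..y}" using inj by (rule inj_on_subset) auto
    then have "\<nu> (T ` {x<..y}) = lam * (\<psi> y - \<psi> x)"
      using image_inj[of "{x<..y}"] diff[OF xy] xy by (auto simp: subset_iff)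
    moreover have "\<nu> (T ` {x<..y}) = \<bar>\<psi> (T x) - \<psi> (T y)\<bar>"
      using monotone_image_halfopen[OF continuous_on_subset[OF cont sub] m inj xy(2)]
    proof (elim disjE conjE)
      assume "T x \<le> T y" "T ` {x<..y} = {T x<..T y}"
      then show ?thesis using diff[of "T x" "T y"] psi_le[of "T x" "T y"] Txy by simp
    next
      assume "T y \<le> T x" "T ` {x<..y} = {T y..<T x}"
      then show ?thesis using right_open[of "T y" "T x"] psi_le[of "T y" "T x"] Txy by simp
    qed
    ultimately show ?thesis by simp
  qed
  have cont_psi: "continuous_on {0..1} \<psi>"
    unfolding continuous_on_iff
  proof (intro ballI allI impI)
    fix x \<epsilon> :: real assume x: "x \<in> {0..1}" and "0 < \<epsilon>"
    then obtain \<eta> where \<eta>: "\<eta> > 0" "\<nu> ({x - \<eta><..<x + \<eta>} \<inter> {0..1}) \<le> \<epsilon> / 2"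
      using small[OF x, of "\<epsilon> / 2"] by auto
    have "dist (\<psi> y) (\<psi> x) < \<epsilon>" if y: "y \<in> {0..1}" "dist y x < \<eta>" for y
    proof -
      have "\<nu> {min x y..max x y} \<le> \<nu> ({x - \<eta><..<x + \<eta>} \<inter> {0..1})"
        by (rule mono) (use x y in \<open>auto simp: dist_real_def min_def max_def split: if_splits\<close>)
      moreover have "\<nu> {min x y..max x y} = \<psi> (max x y) - \<psi> (min x y)"
        by (rule closed) (use x y in auto)
      moreover have "dist (\<psi> y) (\<psi> x) = \<psi> (max x y) - \<psi> (min x y)"
        using psi_le[of x y] psi_le[of y x] x y by (auto simp: dist_real_def min_def max_def)
      ultimately show ?thesis using \<eta>(2) \<open>0 < \<epsilon>\<close> by linarith
    qed
    then show "\<exists>d>0. \<forall>x'\<in>{0..1}. dist x' x < d \<longrightarrow> dist (\<psi> x') (\<psi> x) < \<epsilon>"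
      using \<eta>(1) by blast
  qed
  have "\<psi> 0 = 0" using null[of 0] by (simp add: \<psi>_def)
  moreover have "\<psi> 1 = 1" using unit by (simp add: \<psi>_def)
  ultimately show thesis using that[of \<psi>] cont_psi less lip slope by blast
qed

end

section \<open>Entropy bounds from horseshoes and Lipschitz constants\<close>

text \<open>If the intervals meet, the larger left end point belongs to the interval that starts at
  the smaller one, which would take the common value twice. The right end points are treated
  alike.\<close>

lemma intersecting_intervals_eq:
  fixes f :: "real \<Rightarrow> real"
  assumes "inj_on f {p..q}" "inj_on f {p'..q'}" "f p = f p'" "f q = f q'"
    and "p \<le> q" "p' \<le> q'" "{p..q} \<inter> {p'..q'} \<noteq> {}"
  shows "p = p' \<and> q = q'"
proof -
  have int: "p \<le> q'" "p' \<le> q" using assms(7) by auto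
  have "p = p'"
    using int assms inj_onD[OF assms(1), of p p'] inj_onD[OF assms(2), of p p'] by (cases "p \<le> p'") auto
  moreover have "q = q'"
    using int assms inj_onD[OF assms(1), of q q'] inj_onD[OF assms(2), of q q'] by (cases "q \<le> q'") auto
  ultimately show ?thesis by simp
qed

lemma disjoint_compacts_separated:
  fixes K :: "'a \<Rightarrow> real set"
  assumes "finite Y" and K: "\<And>y. y \<in> Y \<Longrightarrow> compact (K y)"
    and disj: "\<And>y y'. y \<in> Y \<Longrightarrow> y' \<in> Y \<Longrightarrow> y \<noteq> y' \<Longrightarrow> K y \<inter> K y' = {}"
  obtains \<epsilon> where "\<epsilon> > 0"
    "\<And>y y' z z'. y \<in> Y \<Longrightarrow> y' \<in> Y \<Longrightarrow> y \<noteq> y' \<Longrightarrow> z \<in> K y \<Longrightarrow> z' \<in> K y' \<Longrightarrow> \<epsilon> < dist z z'"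
proof -
  have "\<exists>d>0. \<forall>z\<in>K y. \<forall>z'\<in>K y'. d \<le> dist z z'" if "y \<in> Y" "y' \<in> Y" "y \<noteq> y'" for y y'
    using separate_compact_closed[OF K[OF that(1)] compact_imp_closed[OF K[OF that(2)]] disj[OF that]] by simp
  then obtain d where d: "\<And>y y'. y \<in> Y \<Longrightarrow> y' \<in> Y \<Longrightarrow> y \<noteq> y' \<Longrightarrow>
      0 < d y y' \<and> (\<forall>z\<in>K y. \<forall>z'\<in>K y'. d y y' \<le> dist z z')" by metis
  \<comment> \<open>The 1 keeps the minimum defined when there are no pairs. Half of the minimum is
    used below to get the strict inequality that \<open>separated_set\<close> asks for.\<close>
  define D where "D = insert 1 ((\<lambda>(y, y'). d y y') ` {(y, y'). y \<in> Y \<and> y' \<in> Y \<and> y \<noteq> y'})"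
  have "finite {(y, y'). y \<in> Y \<and> y' \<in> Y \<and> y \<noteq> y'}"
    by (rule finite_subset[of _ "Y \<times> Y"]) (use assms(1) in auto)
  then have fin: "finite D" by (simp add: D_def)
  have "Min D > 0" using fin d by (auto simp: D_def)
  moreover have "Min D / 2 < dist z z'" if y: "y \<in> Y" "y' \<in> Y" "y \<noteq> y'" "z \<in> K y" "z' \<in> K y'" for y y' z z'
  proof -
    have "d y y' \<in> D" unfolding D_def using y by (intro insertI2 image_eqI[of _ _ "(y, y')"]) auto
    then have "Min D \<le> d y y'" using fin by simp
    also have "\<dots> \<le> dist z z'" using d[OF y(1-3)] y by blast
    finally show ?thesis using \<open>Min D > 0\<close> by linarith
  qed
  ultimately show thesis using that[of "Min D / 2"] by simp
qed

text \<open>Built from the last symbol backwards: the point for the tail lies in \<open>i\<close>,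
  so it has a preimage in the set that the first symbol prescribes.\<close>

lemma horseshoe_orbits:
  assumes "\<And>y. y \<in> Y \<Longrightarrow> K y \<subseteq> i \<and> i \<subseteq> (T ^^ n) ` K y" and "i \<noteq> {}" and "set ys \<subseteq> Y"
  shows "\<exists>x\<in>i. \<forall>l<length ys. (T ^^ (n * l)) x \<in> K (ys ! l)"
  using assms(3)
proof (induction ys)
  case Nil
  then show ?case using assms(2) by auto
next
  case (Cons y ys)
  then obtain x where x: "x \<in> i" "\<And>l. l < length ys \<Longrightarrow> (T ^^ (n * l)) x \<in> K (ys ! l)" by auto
  have y: "y \<in> Y" using Cons.prems by simp
  then obtain z where z: "z \<in> K y" "(T ^^ n) z = x" using assms(1)[OF y] x(1) by blast
  have "(T ^^ (n * l)) z \<in> K ((y # ys) ! l)" if "l < length (y # ys)" for l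
  proof (cases l)
    case (Suc k)
    have "(T ^^ (n * l)) z = (T ^^ (n * k)) ((T ^^ n) z)"
      using funpow_add[of "n * k" n T] by (simp add: Suc add.commute)
    then show ?thesis using x(2)[of k] that Suc z by simp
  qed (use z in simp)
  then show ?case using assms(1)[OF y] z(1) by blast
qed

text \<open>Itineraries of length \<open>N\<close> give \<open>card Y ^ N\<close> points, and two
  itineraries that differ are separated, at some multiple of \<open>n\<close>, by the common gap of
  the disjoint compact sets. This gives the growth rate along the times \<open>n * N\<close>, and a
  subsequence suffices for a limsup.\<close>

lemma horseshoe_htop:
  assumes Y: "finite Y" "Y \<noteq> {}" and "n > 0" and i: "i \<noteq> {}" "i \<subseteq> {0..1}"
    and cover: "\<And>y. y \<in> Y \<Longrightarrow> K y \<subseteq> i \<and> i \<subseteq> (T ^^ n) ` K y"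
    and K: "\<And>y. y \<in> Y \<Longrightarrow> compact (K y)"
    and disj: "\<And>y y'. y \<in> Y \<Longrightarrow> y' \<in> Y \<Longrightarrow> y \<noteq> y' \<Longrightarrow> K y \<inter> K y' = {}"
  shows "ereal (ln (real (card Y)) / real n) \<le> htop T"
proof -
  obtain \<epsilon> where \<epsilon>: "\<epsilon> > 0"
    "\<And>y y' z z'. y \<in> Y \<Longrightarrow> y' \<in> Y \<Longrightarrow> y \<noteq> y' \<Longrightarrow> z \<in> K y \<Longrightarrow> z' \<in> K y' \<Longrightarrow> \<epsilon> < dist z z'"
    by (rule disjoint_compacts_separated[of Y K, OF Y(1) K disj]) blast+
  define a where "a n = (SUP E\<in>{E. separated_set T n \<epsilon> E \<and> E \<noteq> {}}. ereal (ln (real (card E)) / real n))" for n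
  have card_pos: "card Y > 0" using Y by (simp add: card_gt_0_iff)
  have ge: "ereal (ln (real (card Y)) / real n) \<le> a (n * Suc N)" for N
  proof -
    define W where "W = {ys. set ys \<subseteq> Y \<and> length ys = Suc N}"
    have cardW: "card W = card Y ^ Suc N" unfolding W_def by (rule card_lists_length_eq[OF Y(1)])
    have "\<exists>x\<in>i. \<forall>l<Suc N. (T ^^ (n * l)) x \<in> K (ys ! l)" if "ys \<in> W" for ys
      using horseshoe_orbits[where Y = Y and K = K and i = i and T = T and n = n and ys = ys, OF cover i(1)] that by (auto simp: W_def)
    then obtain g where g: "\<And>ys. ys \<in> W \<Longrightarrow> g ys \<in> i"
      "\<And>ys l. ys \<in> W \<Longrightarrow> l < Suc N \<Longrightarrow> (T ^^ (n * l)) (g ys) \<in> K (ys ! l)" by metis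
    have sep: "\<exists>k<n * Suc N. \<epsilon> < dist ((T ^^ k) (g ys)) ((T ^^ k) (g zs))"
      if w: "ys \<in> W" "zs \<in> W" "ys \<noteq> zs" for ys zs
    proof -
      obtain l where l: "l < Suc N" "ys ! l \<noteq> zs ! l"
        using w nth_equalityI[of ys zs] by (auto simp: W_def)
      have "ys ! l \<in> Y" "zs ! l \<in> Y" using w l by (auto simp: W_def subset_iff)
      then have "\<epsilon> < dist ((T ^^ (n * l)) (g ys)) ((T ^^ (n * l)) (g zs))"
        using \<epsilon>(2)[OF _ _ l(2) g(2)[OF w(1) l(1)] g(2)[OF w(2) l(1)]] by blast
      moreover have "n * l < n * Suc N" using mult_less_mono2[OF l(1) \<open>n > 0\<close>] .
      ultimately show ?thesis by blast
    qed
    have inj: "inj_on g W"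
    proof (rule inj_onI, rule ccontr)
      fix ys zs assume "ys \<in> W" "zs \<in> W" "g ys = g zs" "ys \<noteq> zs"
      then show False using sep[of ys zs] \<epsilon>(1) by auto
    qed
    have finW: "finite W" unfolding W_def by (rule finite_lists_length_eq[OF Y(1)])
    have "separated_set T (n * Suc N) \<epsilon> (g ` W)"
      unfolding separated_set_def
    proof (intro conjI ballI impI)
      show "finite (g ` W)" using finW by simp
      show "g ` W \<subseteq> {0..1}" using g(1) i(2) by blast
      fix x y assume "x \<in> g ` W" "y \<in> g ` W" "x \<noteq> y"
      then show "\<exists>k<n * Suc N. \<epsilon> < dist ((T ^^ k) x) ((T ^^ k) y)" using sep by blast
    qed
    moreover have "W \<noteq> {}" using cardW card_pos by auto
    ultimately have "ereal (ln (real (card (g ` W))) / real (n * Suc N)) \<le> a (n * Suc N)"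
      unfolding a_def by (intro SUP_upper) auto
    moreover have "ln (real (card (g ` W))) / real (n * Suc N) = ln (real (card Y)) / real n"
    proof -
      have "ln (real (card (g ` W))) = real (Suc N) * ln (real (card Y))"
        using card_pos by (simp add: card_image[OF inj] cardW ln_realpow del: power_Suc)
      then show ?thesis unfolding of_nat_mult by (simp del: of_nat_Suc)
    qed
    ultimately show ?thesis by simp
  qed
  have "strict_mono (\<lambda>N. n * Suc N)" using \<open>n > 0\<close> by (intro strict_monoI) simp
  then have "limsup (a \<circ> (\<lambda>N. n * Suc N)) \<le> limsup a" by (rule limsup_subseq_mono)
  moreover have "ereal (ln (real (card Y)) / real n) \<le> limsup (a \<circ> (\<lambda>N. n * Suc N))"
    by (rule le_Limsup) (use ge in auto)
  ultimately have "ereal (ln (real (card Y)) / real n) \<le> limsup a" by (rule order_trans[rotated])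
  also have "\<dots> \<le> htop T"
    unfolding htop_def a_def by (rule SUP_upper) (use \<epsilon>(1) in simp)
  finally show ?thesis .
qed

lemma card_gapped_le:
  fixes f :: "'a \<Rightarrow> real"
  assumes "finite E" "0 < \<eta>" "\<And>x. x \<in> E \<Longrightarrow> f x \<in> {0..1}"
    and gap: "\<And>x y. x \<in> E \<Longrightarrow> y \<in> E \<Longrightarrow> x \<noteq> y \<Longrightarrow> \<eta> \<le> \<bar>f x - f y\<bar>"
  shows "real (card E) \<le> 1 / \<eta> + 1"
proof -
  define k where "k x = nat \<lfloor>f x / \<eta>\<rfloor>" for x
  have k: "real (k x) \<le> f x / \<eta>" "f x / \<eta> < real (k x) + 1" if "x \<in> E" for x
  proof -
    have "0 \<le> f x / \<eta>" using assms(2,3) that by auto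
    then have "real (k x) = of_int \<lfloor>f x / \<eta>\<rfloor>" by (simp add: k_def)
    then show "real (k x) \<le> f x / \<eta>" "f x / \<eta> < real (k x) + 1" by linarith+
  qed
  have "inj_on k E"
  proof (rule inj_onI, rule ccontr)
    fix x y assume xy: "x \<in> E" "y \<in> E" "k x = k y" "x \<noteq> y"
    have "\<bar>f x / \<eta> - f y / \<eta>\<bar> < 1" using k[OF xy(1)] k[OF xy(2)] xy(3) by linarith
    then have "\<bar>f x - f y\<bar> < \<eta>"
      using assms(2) by (simp add: diff_divide_distrib[symmetric] abs_divide)
    then show False using gap[OF xy(1,2,4)] by simp
  qed
  moreover have "k ` E \<subseteq> {..nat \<lfloor>1 / \<eta>\<rfloor>}"
    unfolding k_def using assms(2,3) by (auto intro!: nat_mono floor_mono divide_right_mono)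
  ultimately have "card E \<le> card {..nat \<lfloor>1 / \<eta>\<rfloor>}" by (meson card_inj_on_le finite_atMost)
  then have "real (card E) \<le> real (nat \<lfloor>1 / \<eta>\<rfloor>) + 1" by simp
  also have "real (nat \<lfloor>1 / \<eta>\<rfloor>) = of_int \<lfloor>1 / \<eta>\<rfloor>" using assms(2) by simp
  finally show ?thesis by linarith
qed

text \<open>Measured by \<open>\<psi>\<close>, orbits move apart at most by the factor
  \<open>lam\<close> per step. Points separated within \<open>n\<close> steps thus have gaps of
  order \<open>1 / lam ^ n\<close>, and the unit interval has room for order \<open>lam ^ n\<close>
  of them. Uniform continuity of the inverse of \<open>\<psi>\<close> translates the original
  separation into this metric.\<close>

lemma htop_le_lipschitz:
  fixes \<psi> :: "real \<Rightarrow> real"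
  assumes range: "\<And>x. x \<in> {0..1} \<Longrightarrow> T x \<in> {0..1}"
    and cont: "continuous_on {0..1} \<psi>" and inj: "inj_on \<psi> {0..1}" and unit: "\<psi> ` {0..1} \<subseteq> {0..1}"
    and lam: "1 \<le> lam"
    and lip: "\<And>x y. x \<in> {0..1} \<Longrightarrow> y \<in> {0..1} \<Longrightarrow> \<bar>\<psi> (T x) - \<psi> (T y)\<bar> \<le> lam * \<bar>\<psi> x - \<psi> y\<bar>"
  shows "htop T \<le> ereal (ln lam)"
  unfolding htop_def
proof (rule SUP_least)
  fix \<epsilon> :: real assume "\<epsilon> \<in> {0<..}"
  then have e0: "0 < \<epsilon>" by simp
  obtain \<phi> where \<phi>: "homeomorphism {0..1} (\<psi> ` {0..1}) \<psi> \<phi>"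
    using homeomorphism_compact[OF _ cont refl inj] by auto
  have "uniformly_continuous_on (\<psi> ` {0..1}) \<phi>"
    by (rule compact_uniformly_continuous[OF homeomorphism_cont2[OF \<phi>]])
      (rule compact_continuous_image[OF cont compact_Icc])
  then obtain \<delta> where \<delta>: "\<delta> > 0" "\<And>x y. x \<in> {0..1} \<Longrightarrow> y \<in> {0..1} \<Longrightarrow> dist (\<psi> y) (\<psi> x) < \<delta> \<Longrightarrow> dist y x < \<epsilon>"
    unfolding uniformly_continuous_on_def using e0 homeomorphism_apply1[OF \<phi>] by (metis imageI)
  have range_n: "(T ^^ k) x \<in> {0..1}" if "x \<in> {0..1}" for k x
    by (induction k) (use that range in auto)
  have lip_n: "\<bar>\<psi> ((T ^^ k) x) - \<psi> ((T ^^ k) y)\<bar> \<le> lam ^ k * \<bar>\<psi> x - \<psi> y\<bar>"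
    if "x \<in> {0..1}" "y \<in> {0..1}" for k x y
  proof (induction k)
    case (Suc k)
    have "\<bar>\<psi> ((T ^^ Suc k) x) - \<psi> ((T ^^ Suc k) y)\<bar> \<le> lam * \<bar>\<psi> ((T ^^ k) x) - \<psi> ((T ^^ k) y)\<bar>"
      using lip[OF range_n[OF that(1)] range_n[OF that(2)]] by simp
    also have "\<dots> \<le> lam * (lam ^ k * \<bar>\<psi> x - \<psi> y\<bar>)" using Suc lam by (intro mult_left_mono) auto
    finally show ?case by (simp add: mult.assoc)
  qed simp
  \<comment> \<open>Chosen so that \<open>1 / (\<delta> / lam ^ n) + 1\<close> is at most
    \<open>C * lam ^ n\<close>, as \<open>1 \<le> lam\<close>.\<close>
  define C where "C = 1 / \<delta> + 1"
  have C: "C > 0" using \<delta>(1) by (simp add: C_def add_pos_pos)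
  have card_le: "real (card E) \<le> C * lam ^ n" if E: "separated_set T n \<epsilon> E" for n E
  proof -
    have gap: "\<delta> / lam ^ n \<le> \<bar>\<psi> x - \<psi> y\<bar>" if xy: "x \<in> E" "y \<in> E" "x \<noteq> y" for x y
    proof -
      obtain k where k: "k < n" "dist ((T ^^ k) x) ((T ^^ k) y) > \<epsilon>"
        using E xy unfolding separated_set_def by blast
      have xy': "x \<in> {0..1}" "y \<in> {0..1}" using E xy unfolding separated_set_def by blast+
      have "\<delta> \<le> dist (\<psi> ((T ^^ k) x)) (\<psi> ((T ^^ k) y))"
        using \<delta>(2)[OF range_n[OF xy'(2)] range_n[OF xy'(1)], of k k] k(2) by force
      also have "\<dots> \<le> lam ^ k * \<bar>\<psi> x - \<psi> y\<bar>" using lip_n[OF xy', of k] by (simp add: dist_real_def)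
      also have "\<dots> \<le> lam ^ n * \<bar>\<psi> x - \<psi> y\<bar>"
        using lam k(1) by (intro mult_right_mono power_increasing) auto
      finally show ?thesis using lam by (simp add: field_simps)
    qed
    have "real (card E) \<le> 1 / (\<delta> / lam ^ n) + 1"
    proof (rule card_gapped_le[where f = \<psi>, OF _ _ _ gap])
      show "\<psi> x \<in> {0..1}" if "x \<in> E" for x
        using E unit that unfolding separated_set_def by blast
      show "finite E" using E unfolding separated_set_def by blast
    qed (use \<delta>(1) lam in auto)
    also have "\<dots> \<le> lam ^ n / \<delta> + lam ^ n" using lam by simp
    finally show ?thesis by (simp add: C_def algebra_simps)
  qed
  have "(SUP E\<in>{E. separated_set T n \<epsilon> E \<and> E \<noteq> {}}. ereal (ln (real (card E)) / real n)) \<le> ereal (ln C / real n + ln lam)"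
    if n: "n > 0" for n
  proof (rule SUP_least)
    fix E assume "E \<in> {E. separated_set T n \<epsilon> E \<and> E \<noteq> {}}"
    then have E: "separated_set T n \<epsilon> E" "E \<noteq> {}" "finite E" by (auto simp: separated_set_def)
    then have "0 < real (card E)" by (simp add: card_gt_0_iff)
    then have "ln (real (card E)) \<le> ln (C * lam ^ n)" using card_le[OF E(1)] by simp
    also have "\<dots> = ln C + real n * ln lam" using C lam by (simp add: ln_mult ln_realpow)
    finally have "ln (real (card E)) / real n \<le> (ln C + real n * ln lam) / real n"
      by (rule divide_right_mono) simp
    also have "\<dots> = ln C / real n + ln lam" using n by (simp add: field_simps)
    finally show "ereal (ln (real (card E)) / real n) \<le> ereal (ln C / real n + ln lam)" by simp
  qed
  then have "limsup (\<lambda>n. SUP E\<in>{E. separated_set T n \<epsilon> E \<and> E \<noteq> {}}. ereal (ln (real (card E)) / real n))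
      \<le> limsup (\<lambda>n. ereal (ln C / real n + ln lam))"
    by (intro Limsup_mono eventually_mono[OF eventually_gt_at_top[of 0]])
  also have "(\<lambda>n. ereal (ln C / real n + ln lam)) \<longlonglongrightarrow> ereal (0 + ln lam)"
    by (intro tendsto_ereal tendsto_add tendsto_const lim_const_over_n)
  then have "limsup (\<lambda>n. ereal (ln C / real n + ln lam)) = ereal (ln lam)"
    using lim_imp_Limsup[OF sequentially_bot] by force
  finally show "limsup (\<lambda>n. SUP E\<in>{E. separated_set T n \<epsilon> E \<and> E \<noteq> {}}. ereal (ln (real (card E)) / real n))
      \<le> ereal (ln lam)" .
qed

section \<open>Branches of iterates and the lower entropy bound\<close>

context leo_markov_map
begin

text \<open>The branch at \<open>T x\<close> is pulled back through the maximal monotonicity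
  interval at \<open>x\<close>, which covers the whole cell of \<open>T x\<close> by the Markov
  property. Genericity passes backwards along the orbit, so \<open>T x\<close> is interior to its
  cell, as that property requires.\<close>

lemma branch:
  assumes "i \<in> P" "x \<in> i" "j \<in> P" "(T ^^ n) x \<in> j" "(T ^^ n) x \<in> G"
  shows "\<exists>p q. p < q \<and> {p..q} \<subseteq> i \<and> x \<in> {p..q} \<and> inj_on (T ^^ n) {p..q} \<and> (T ^^ n) ` {p..q} = j"
  using assms(1,2,4,5)
proof (induction n arbitrary: i x)
  case 0
  then have "i = j" using G_cell_unique[of x i j] assms(3) by simp
  moreover obtain a b where "a < b" "i = {a..b}" using interval_P[OF 0(1)] by metis
  ultimately show ?case using 0 by (intro exI[of _ a] exI[of _ b]) auto
next
  case (Suc n)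
  have x01: "x \<in> {0..1}" using Suc.prems P_subset_unit by blast
  have Tn: "(T ^^ Suc n) = (T ^^ n) \<circ> T" by (rule funpow_Suc_right)
  have Tx: "(T ^^ n) (T x) \<in> j" "(T ^^ n) (T x) \<in> G" using Suc.prems(3,4) unfolding Tn by simp_all
  have TxG: "T x \<in> G" using G_funpow_backward[OF in_unit[OF x01] Tx(2)] .
  obtain \<alpha> where \<alpha>: "\<alpha> \<in> P" "T x \<in> interior \<alpha>" using G_cell[OF TxG] by blast
  then have "T x \<in> \<alpha>" using interior_subset by blast
  from Suc.IH[OF \<alpha>(1) this Tx] obtain p q where pq: "p < q" "{p..q} \<subseteq> \<alpha>" "T x \<in> {p..q}"
    "inj_on (T ^^ n) {p..q}" "(T ^^ n) ` {p..q} = j" by blast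
  obtain J where J: "maximal_monotonicity_interval T i J" "x \<in> J"
    using maximal_at[OF Suc.prems(1,2)] by blast
  note J' = maximal_props[OF Suc.prems(1) J(1)]
  have "\<alpha> \<subseteq> T ` J" using maximal_covers[OF Suc.prems(1) \<alpha>(1) J \<alpha>(2)] .
  moreover have "p \<in> \<alpha>" "q \<in> \<alpha>" using pq(1,2) by auto
  \<comment> \<open>The order of \<open>s\<close> and \<open>t\<close> depends on the direction of
    \<open>T\<close> on \<open>J\<close>, hence closed segments instead of intervals.\<close>
  ultimately obtain s t where st: "s \<in> J" "T s = p" "t \<in> J" "T t = q" by blast
  have seg: "closed_segment s t \<subseteq> J"
    using J'(1) st by (simp add: closed_segment_subset is_interval_convex)
  have J01: "J \<subseteq> {0..1}" using J'(2) P_subset_unit[OF Suc.prems(1)] by blast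
  have cont_seg: "continuous_on (closed_segment s t) T"
    using continuous_on_subset[OF cont] seg J01 by blast
  have inj_seg: "inj_on T (closed_segment s t)" using J'(4) seg by (rule inj_on_subset)
  have img: "T ` closed_segment s t = {p..q}"
    using continuous_injective_image_segment_1[OF cont_seg inj_seg] st pq(1)
    by (simp add: closed_segment_eq_real_ivl)
  obtain y where y: "y \<in> closed_segment s t" "T y = T x" using pq(3) unfolding img[symmetric] by force
  then have "x = y" using J'(4) J(2) seg by (auto dest: inj_onD)
  then have x: "x \<in> closed_segment s t" using y by simp
  have "s \<noteq> t" using st pq(1) by auto
  have "inj_on (T ^^ Suc n) (closed_segment s t)"
    unfolding Tn using inj_seg pq(4) by (intro comp_inj_on) (simp_all add: img)
  moreover have "(T ^^ Suc n) ` closed_segment s t = j"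
    unfolding Tn image_comp[symmetric] img by (rule pq(5))
  moreover have "closed_segment s t = {min s t..max s t}" by (simp add: closed_segment_eq_real_ivl min_def max_def)
  moreover have "closed_segment s t \<subseteq> i" using seg J'(2) by blast
  moreover have "min s t < max s t" using \<open>s \<noteq> t\<close> by auto
  ultimately show ?case using x by metis
qed

text \<open>
  Two branches over the same cell that meet in an end point have opposite orientations, so the
  branches of one orientation form a horseshoe. This costs the factor 2.
\<close>

lemma matrix_power_le_exp_htop:
  assumes i: "i \<in> P" and n: "n > 0" and s: "htop T < ereal s"
  shows "matrix_power P M n i i \<le> 2 * exp s ^ n"
proof -
  obtain c where c: "c \<in> i" "c \<in> G" using ex_generic[OF i] by blast
  obtain a b where ab: "a < b" "i = {a..b}" using interval_P[OF i] by metis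
  define X where "X = {x\<in>i. (T ^^ n) x = c}"
  have "ennreal (matrix_power P M n i i) = (\<integral>\<^sup>+x. indicator X x \<partial>count_space i)"
    unfolding matrix_power_count[OF i i c] by (intro nn_integral_cong) (simp add: X_def indicator_def)
  also have "\<dots> = emeasure (count_space i) X" by (rule nn_integral_indicator) (auto simp: X_def)
  finally have em: "ennreal (matrix_power P M n i i) = emeasure (count_space i) X" .
  have X: "X \<subseteq> i" by (auto simp: X_def)
  have finX: "finite X"
  proof (rule ccontr)
    assume "infinite X"
    then have "emeasure (count_space i) X = top" using X by (simp add: emeasure_count_space_infinite)
    then show False using em by simp
  qed
  have card: "matrix_power P M n i i = real (card X)"
    using em X finX matrix_power_props[OF i, of n] i by (simp add: emeasure_count_space_finite ennreal_of_nat_eq_real_of_nat)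
  have "\<exists>p q. p < q \<and> {p..q} \<subseteq> i \<and> x \<in> {p..q} \<and> inj_on (T ^^ n) {p..q} \<and> (T ^^ n) ` {p..q} = i" if "x \<in> X" for x
    using branch[OF i _ i, of x n] that c by (auto simp: X_def)
  then obtain p q where pq: "p x < q x" "{p x..q x} \<subseteq> i" "x \<in> {p x..q x}"
    "inj_on (T ^^ n) {p x..q x}" "(T ^^ n) ` {p x..q x} = i" if "x \<in> X" for x by metis
  have ends: "(T ^^ n) (p x) = a \<and> (T ^^ n) (q x) = b \<or> (T ^^ n) (p x) = b \<and> (T ^^ n) (q x) = a"
    if x: "x \<in> X" for x
  proof -
    have seg: "closed_segment (p x) (q x) = {p x..q x}" using pq(1)[OF x] by (simp add: closed_segment_eq_real_ivl)
    have "continuous_on {p x..q x} (T ^^ n)"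
      using continuous_on_subset[OF cont_funpow] pq(2)[OF x] P_subset_unit[OF i] by blast
    then have "closed_segment ((T ^^ n) (p x)) ((T ^^ n) (q x)) = {a..b}"
      using continuous_injective_image_segment_1[of "p x" "q x" "T ^^ n"] pq(4,5)[OF x] ab by (simp add: seg)
    then show ?thesis using ab(1) by (auto simp: closed_segment_eq_real_ivl Icc_eq_Icc split: if_splits)
  qed
  define Inc where "Inc = {x\<in>X. (T ^^ n) (p x) = a}"
  \<comment> \<open>The larger of the two orientation classes has at least half of the
    branches.\<close>
  define Y where "Y = (if card X \<le> 2 * card Inc then Inc else X - Inc)"
  have YX: "Y \<subseteq> X" by (auto simp: Y_def Inc_def)
  have "Inc \<subseteq> X" by (auto simp: Inc_def)
  then have "card (X - Inc) = card X - card Inc" using finX by (meson card_Diff_subset finite_subset)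
  then have cardY: "card X \<le> 2 * card Y" by (auto simp: Y_def)
  have same: "(T ^^ n) (p x) = (T ^^ n) (p y) \<and> (T ^^ n) (q x) = (T ^^ n) (q y)" if "x \<in> Y" "y \<in> Y" for x y
  proof -
    have "x \<in> X" "y \<in> X" using that YX by blast+
    then show ?thesis using ends[of x] ends[of y] ab(1) that by (auto simp: Y_def Inc_def split: if_splits)
  qed
  \<comment> \<open>Equal orientation means equal end values, so branches that meet coincide; the
    common interval would then contain two preimages of \<open>c\<close>.\<close>
  have disj: "{p x..q x} \<inter> {p y..q y} = {}" if xy: "x \<in> Y" "y \<in> Y" "x \<noteq> y" for x y
  proof (rule ccontr)
    assume ne: "{p x..q x} \<inter> {p y..q y} \<noteq> {}"
    have X: "x \<in> X" "y \<in> X" using xy YX by blast+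
    have "p x = p y \<and> q x = q y"
      using intersecting_intervals_eq[OF pq(4)[OF X(1)] pq(4)[OF X(2)] _ _ _ _ ne] same[OF xy(1,2)]
        pq(1)[OF X(1)] pq(1)[OF X(2)] by simp
    then have "y \<in> {p x..q x}" using pq(3)[OF X(2)] by simp
    then show False using pq(3,4)[OF X(1)] X xy(3) by (auto simp: X_def dest: inj_onD)
  qed
  show ?thesis
  proof (cases "Y = {}")
    case True
    then show ?thesis using cardY card by simp
  next
    case False
    have "ereal (ln (real (card Y)) / real n) \<le> htop T"
    proof (rule horseshoe_htop[where i = i and K = "\<lambda>x. {p x..q x}"])
      show "finite Y" using finX YX by (rule finite_subset[rotated])
      show "i \<noteq> {}" using ab by simp
      show "i \<subseteq> {0..1}" by (rule P_subset_unit[OF i])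
      show "{p y..q y} \<subseteq> i \<and> i \<subseteq> (T ^^ n) ` {p y..q y}" if "y \<in> Y" for y
        using pq(2,5)[of y] that YX by blast
    qed (use False n disj in auto)
    then have "ln (real (card Y)) / real n < s" using s by (metis ereal_less_eq(3) le_less_trans less_ereal.simps(1))
    then have "ln (real (card Y)) < real n * s" using n by (simp add: field_simps)
    moreover have "0 < real (card Y)" using False finX YX finite_subset by (auto simp: card_gt_0_iff)
    ultimately have "real (card Y) < exp (real n * s)" by (metis exp_less_cancel_iff exp_ln)
    then have "real (card Y) < exp s ^ n" by (simp add: exp_of_nat_mult)
    moreover have "real (card X) \<le> 2 * real (card Y)" using cardY by linarith
    ultimately show ?thesis unfolding card by linarith
  qed
qed

text \<open>If the entropy were below some \<open>s < ln lam\<close>, the diagonal coefficients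
  would be at most \<open>2 * exp s ^ n\<close>. The radius of convergence would then be at least
  \<open>exp (- s)\<close>, which exceeds \<open>1 / lam\<close>.\<close>

lemma htop_ge_conv_radius:
  assumes i: "i \<in> P" and lam: "lam > 0"
    and R: "conv_radius (\<lambda>n. matrix_power P M n i i) = ereal (1 / lam)"
  shows "ereal (ln lam) \<le> htop T"
proof (rule ccontr)
  assume "\<not> ereal (ln lam) \<le> htop T"
  then have "htop T < ereal (ln lam)" by simp
  then obtain s where s: "htop T < ereal s" "ereal s < ereal (ln lam)" by (rule ereal_dense2[THEN exE]) blast
  have "ereal (exp (- s)) \<le> conv_radius (\<lambda>n. matrix_power P M n i i)"
  proof (rule conv_radius_geI_ex')
    fix r :: real assume r: "0 < r" "ereal r < ereal (exp (- s))"
    then have lt: "exp s * r < 1" by (simp add: exp_minus field_simps)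
    have "summable (\<lambda>n. 2 * (exp s * r) ^ n)"
      using r(1) lt by (intro summable_mult summable_geometric) simp
    then have "summable (\<lambda>n. matrix_power P M n i i * r ^ n)"
    proof (rule summable_comparison_test_ev[rotated])
      have "norm (matrix_power P M n i i * r ^ n) \<le> 2 * (exp s * r) ^ n" if "n > 0" for n
      proof -
        have "matrix_power P M n i i * r ^ n \<le> (2 * exp s ^ n) * r ^ n"
          using matrix_power_le_exp_htop[OF i that s(1)] r(1) by (intro mult_right_mono) auto
        moreover have "0 \<le> matrix_power P M n i i" using matrix_power_props[OF i, of n] i by blast
        ultimately show ?thesis using r(1) by (simp add: power_mult_distrib abs_mult)
      qed
      then show "eventually (\<lambda>n. norm (matrix_power P M n i i * r ^ n) \<le> 2 * (exp s * r) ^ n) sequentially"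
        using eventually_gt_at_top[of 0] by (rule eventually_mono[rotated])
    qed
    then show "summable (\<lambda>n. matrix_power P M n i i * of_real r ^ n)" by simp
  qed
  then have "exp (- s) \<le> 1 / lam" unfolding R by simp
  then have "lam \<le> exp s" using lam by (simp add: exp_minus field_simps)
  then have "ln lam \<le> s" using lam by (metis ln_exp ln_le_cancel_iff exp_gt_zero)
  then show False using s(2) by simp
qed

end

section \<open>Constant slope of the conjugate and conclusion\<close>

context weighted_markov_map
begin

text \<open>On a monotone piece the direction of \<open>T\<close> resolves the absolute value in the
  slope equation with one sign, so the conjugate is affine on the image of the piece. Only images of
  end points of pieces and of points of \<open>E\<close> remain, and these are countably
  many.\<close>

lemma conjugate_constant_slope:
  assumes hom: "homeomorphism {0..1} {0..1} \<psi> \<phi>"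
    and less: "\<And>x y. 0 \<le> x \<Longrightarrow> x < y \<Longrightarrow> y \<le> 1 \<Longrightarrow> \<psi> x < \<psi> y"
    and slope: "\<And>x y. 0 \<le> x \<Longrightarrow> x \<le> y \<Longrightarrow> y \<le> 1 \<Longrightarrow> monotone_map_on {x..y} T \<Longrightarrow>
      \<bar>\<psi> (T x) - \<psi> (T y)\<bar> = lam * (\<psi> y - \<psi> x)"
  shows "constant_slope (\<lambda>v. \<psi> (T (\<phi> v))) lam"
proof -
  let ?S = "\<lambda>v. \<psi> (T (\<phi> v))"
  have psi_le: "\<psi> x \<le> \<psi> y" if "0 \<le> x" "x \<le> y" "y \<le> 1" for x y
    using less[of x y] that by (cases "x = y") auto
  have phi: "\<phi> v \<in> {0..1}" "\<psi> (\<phi> v) = v" if "v \<in> {0..1}" for v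
    using homeomorphism_image2[OF hom] homeomorphism_apply2[OF hom] that by blast+
  have "\<forall>i\<in>P. \<exists>Q. finite Q \<and> \<Union>Q = i \<and> (\<forall>K\<in>Q. \<exists>u v. u < v \<and> K = {u..v} \<and> monotone_map_on K T)"
  proof
    fix i assume i: "i \<in> P"
    obtain Q where "finite Q" "\<Union>Q = i"
      "\<And>K. K \<in> Q \<Longrightarrow> \<exists>u v. u < v \<and> K = {u..v} \<and> monotone_map_on K T \<and> inj_on T K"
      using monotone_pieces[OF i] by metis
    then show "\<exists>Q. finite Q \<and> \<Union>Q = i \<and> (\<forall>K\<in>Q. \<exists>u v. u < v \<and> K = {u..v} \<and> monotone_map_on K T)"
      by (intro exI[of _ Q]) meson
  qed
  then obtain Q where Q: "\<And>i. i \<in> P \<Longrightarrow> finite (Q i)" "\<And>i. i \<in> P \<Longrightarrow> \<Union>(Q i) = i"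
    "\<And>i K. i \<in> P \<Longrightarrow> K \<in> Q i \<Longrightarrow> \<exists>u v. u < v \<and> K = {u..v} \<and> monotone_map_on K T"
    by metis
  define X where "X = E \<union> (\<Union>i\<in>P. \<Union>K\<in>Q i. K - interior K)"
  have piece: "countable (K - interior K)" if iK: "i \<in> P" "K \<in> Q i" for i K
  proof -
    obtain u v where "K = {u..v}" using Q(3)[OF iK] by blast
    then have "K - interior K \<subseteq> {u, v}" by (auto simp: interior_atLeastAtMost_real)
    then show ?thesis by (rule countable_subset) simp
  qed
  have "countable (\<Union>K\<in>Q i. K - interior K)" if "i \<in> P" for i
    by (rule countable_UN[OF countable_finite[OF Q(1)[OF that]] piece[OF that]])
  then have X: "countable X" unfolding X_def using countable_E countable_P by auto
  have deriv: "\<exists>D. (?S has_real_derivative D) (at v within {0..1}) \<and> \<bar>D\<bar> = lam"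
    if v: "v \<in> {0..1}" "v \<notin> \<psi> ` X" for v
  proof -
    define x where "x = \<phi> v"
    have x: "x \<in> {0..1}" "\<psi> x = v" using phi[OF v(1)] by (simp_all add: x_def)
    have "x \<notin> X" using v(2) x(2) by blast
    then obtain i where i: "i \<in> P" "x \<in> interior i" using not_E_interior[OF x(1)] by (auto simp: X_def)
    then obtain K where K: "K \<in> Q i" "x \<in> K" using Q(2)[OF i(1)] interior_subset by blast
    obtain p q where pq: "p < q" "K = {p..q}" "monotone_map_on {p..q} T" using Q(3)[OF i(1) K(1)] by blast
    have "x \<in> interior K" using \<open>x \<notin> X\<close> K i(1) by (auto simp: X_def)
    then have xpq: "p < x" "x < q" using pq(2) by (auto simp: interior_atLeastAtMost_real)
    have sub: "{p..q} \<subseteq> {0..1}" using Q(2)[OF i(1)] K(1) pq(2) P_subset_unit[OF i(1)] by blast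
    then have p01: "0 \<le> p" "q \<le> 1" using pq(1) by auto
    have abs_slope: "\<bar>\<psi> (T s) - \<psi> (T t)\<bar> = lam * (\<psi> t - \<psi> s)" if "p \<le> s" "s \<le> t" "t \<le> q" for s t
      using that p01 by (intro slope monotone_map_on_subset[OF pq(3)]) auto
    have T01: "T s \<in> {0..1}" if "p \<le> s" "s \<le> q" for s using in_unit that p01 by auto
    have "\<exists>c. \<bar>c\<bar> = lam \<and> (\<forall>s t. p \<le> s \<and> s \<le> t \<and> t \<le> q \<longrightarrow> \<psi> (T t) - \<psi> (T s) = c * (\<psi> t - \<psi> s))"
      using pq(3) unfolding monotone_map_on_def
    proof
      assume mono: "mono_on {p..q} T"
      have "\<psi> (T t) - \<psi> (T s) = lam * (\<psi> t - \<psi> s)" if st: "p \<le> s" "s \<le> t" "t \<le> q" for s t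
      proof -
        have "T s \<le> T t" using monotone_onD[OF mono, of s t] st by auto
        then have "\<psi> (T s) \<le> \<psi> (T t)" using psi_le T01[of s] T01[of t] st by auto
        then show ?thesis using abs_slope[OF st] by simp
      qed
      then show ?thesis using lam_pos by (intro exI[of _ lam]) auto
    next
      assume anti: "antimono_on {p..q} T"
      have "\<psi> (T t) - \<psi> (T s) = (- lam) * (\<psi> t - \<psi> s)" if st: "p \<le> s" "s \<le> t" "t \<le> q" for s t
      proof -
        have "T t \<le> T s" using monotone_onD[OF anti, of s t] st by auto
        then have "\<psi> (T t) \<le> \<psi> (T s)" using psi_le T01[of s] T01[of t] st by auto
        then show ?thesis using abs_slope[OF st] by simp
      qed
      then show ?thesis using lam_pos by (intro exI[of _ "- lam"]) auto
    qed
    then obtain c where c: "\<bar>c\<bar> = lam"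
      "\<And>s t. p \<le> s \<Longrightarrow> s \<le> t \<Longrightarrow> t \<le> q \<Longrightarrow> \<psi> (T t) - \<psi> (T s) = c * (\<psi> t - \<psi> s)" by blast
    \<comment> \<open>An affine formula on an open interval around \<open>v\<close> gives the
      derivative from both sides.\<close>
    have lin: "?S v + c * (z - v) = ?S z" if z: "z \<in> {\<psi> p<..<\<psi> q}" for z
    proof -
      have "\<psi> p \<in> {0..1}" "\<psi> q \<in> {0..1}"
        using homeomorphism_image1[OF hom] p01 pq(1) by auto
      then have z01: "z \<in> {0..1}" using z by auto
      note y = phi[OF z01]
      have y01: "0 \<le> \<phi> z" "\<phi> z \<le> 1" using y(1) by auto
      have "p < \<phi> z" using psi_le[of "\<phi> z" p] y p01 pq(1) z y01 by (cases "\<phi> z \<le> p") auto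
      moreover have "\<phi> z < q" using psi_le[of q "\<phi> z"] y p01 pq(1) z y01 by (cases "q \<le> \<phi> z") auto
      ultimately show ?thesis
        using c(2)[of x "\<phi> z"] c(2)[of "\<phi> z" x] xpq x(2) y(2)
        by (cases "x \<le> \<phi> z") (auto simp: x_def[symmetric] algebra_simps)
    qed
    have "((\<lambda>z. ?S v + c * (z - v)) has_real_derivative c) (at v)"
      by (auto intro!: derivative_eq_intros)
    moreover have "v \<in> {\<psi> p<..<\<psi> q}"
      using less[of p x] less[of x q] xpq x p01 by auto
    ultimately have "(?S has_real_derivative c) (at v)"
      by (rule has_field_derivative_transform_within_open[OF _ open_greaterThanLessThan]) (rule lin)
    then show ?thesis using c(1) has_field_derivative_at_within by blast
  qed
  have "{v\<in>{0..1}. \<not> (\<exists>D. (?S has_real_derivative D) (at v within {0..1}) \<and> \<bar>D\<bar> = lam)} \<subseteq> \<psi> ` X"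
  proof (rule subsetI, rule ccontr)
    fix v assume "v \<in> {v\<in>{0..1}. \<not> (\<exists>D. (?S has_real_derivative D) (at v within {0..1}) \<and> \<bar>D\<bar> = lam)}"
      and "v \<notin> \<psi> ` X"
    then show False using deriv[of v] by blast
  qed
  then show ?thesis
    unfolding constant_slope_def by (rule countable_subset) (rule countable_image[OF X])
qed

lemma linearizable_of_htop:
  assumes htop: "ereal (ln lam) \<le> htop T"
  shows "linearizable T"
proof -
  obtain \<psi> :: "real \<Rightarrow> real" where cont_psi: "continuous_on {0..1} \<psi>" and ends: "\<psi> 0 = 0" "\<psi> 1 = 1" and
    less: "\<And>x y. 0 \<le> x \<Longrightarrow> x < y \<Longrightarrow> y \<le> 1 \<Longrightarrow> \<psi> x < \<psi> y" and
    lip: "\<And>x y. x \<in> {0..1} \<Longrightarrow> y \<in> {0..1} \<Longrightarrow> \<bar>\<psi> (T x) - \<psi> (T y)\<bar> \<le> lam * \<bar>\<psi> x - \<psi> y\<bar>" and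
    slope: "\<And>x y. 0 \<le> x \<Longrightarrow> x \<le> y \<Longrightarrow> y \<le> 1 \<Longrightarrow> monotone_map_on {x..y} T \<Longrightarrow>
      \<bar>\<psi> (T x) - \<psi> (T y)\<bar> = lam * (\<psi> y - \<psi> x)"
    by (rule linearizing_function) blast
  have inj: "inj_on \<psi> {0..1}"
  proof (rule inj_onI)
    fix x y :: real assume "x \<in> {0..1}" "y \<in> {0..1}" "\<psi> x = \<psi> y"
    then show "x = y" using less[of x y] less[of y x] by (cases x y rule: linorder_cases) auto
  qed
  have "\<psi> ` closed_segment 0 1 = closed_segment (\<psi> 0) (\<psi> 1)"
    using cont_psi inj by (intro continuous_injective_image_segment_1) (simp_all add: closed_segment_eq_real_ivl)
  then have img: "\<psi> ` {0..1} = {0..1}" by (simp add: ends closed_segment_eq_real_ivl)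
  obtain \<phi> where hom: "homeomorphism {0..1} {0..1} \<psi> \<phi>"
    using homeomorphism_compact[OF compact_Icc cont_psi img inj] by blast
  \<comment> \<open>With the assumed lower bound this identifies \<open>lam\<close> as the slope
    that \<open>linearizable\<close> prescribes.\<close>
  have "htop T \<le> ereal (ln lam)"
    by (rule htop_le_lipschitz[OF in_unit cont_psi inj _ _ lip]) (use img lam_gt_1 in auto)
  with htop have "htop T = ereal (ln lam)" by simp
  then have exp_htop: "exp (real_of_ereal (htop T)) = lam" using lam_pos by simp
  define S where "S = (\<lambda>v. \<psi> (T (\<phi> v)))"
  have phi_img: "\<phi> ` {0..1} = {0..1}" by (rule homeomorphism_image2[OF hom])
  have "continuous_on {0..1} S"
  proof -
    have "continuous_on {0..1} (T \<circ> \<phi>)"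
      using homeomorphism_cont2[OF hom] cont phi_img by (intro continuous_on_compose) auto
    moreover have "(T \<circ> \<phi>) ` {0..1} \<subseteq> {0..1}" by (metis image_comp onto order_refl phi_img)
    ultimately have "continuous_on {0..1} (\<psi> \<circ> (T \<circ> \<phi>))"
      by (rule continuous_on_compose[OF _ continuous_on_subset[OF cont_psi]])
    then show ?thesis by (simp add: S_def comp_def)
  qed
  moreover have "S ` {0..1} \<subseteq> {0..1}"
  proof clarify
    fix v :: real assume "v \<in> {0..1}"
    then have "T (\<phi> v) \<in> {0..1}" using phi_img in_unit by blast
    then show "S v \<in> {0..1}" unfolding S_def using img by blast
  qed
  ultimately have "interval_map S" by (simp add: interval_map_def)
  moreover have "constant_slope S (exp (real_of_ereal (htop T)))"
    unfolding exp_htop S_def by (rule conjugate_constant_slope[OF hom less slope])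
  moreover have "topologically_conjugate T S"
    unfolding topologically_conjugate_def S_def
    using hom homeomorphism_apply1[OF hom] by (intro exI[of _ \<psi>] exI[of _ \<phi>]) simp
  ultimately show ?thesis unfolding linearizable_def by blast
qed

end

theorem theorem7:
  fixes T :: "real \<Rightarrow> real"
  assumes "T \<in> CPMM" and "leo T" and "recurrent_map T"
  shows "linearizable T"
proof -
  obtain P where P: "markov_partition T P" "recurrent_matrix P (transition_matrix T)"
    using assms(3) unfolding recurrent_map_def by blast
  interpret leo_markov_map T P
    using assms P(1) by unfold_locales (simp_all add: CPMM_def)
  obtain w lam j0 where w: "1 < lam" "\<And>i. 0 \<le> w i" "(\<integral>\<^sup>+i. ennreal (w i) \<partial>count_space P) = 1"
    "\<And>i. i \<in> P \<Longrightarrow> (\<integral>\<^sup>+j. ennreal (M i j) * ennreal (w j) \<partial>count_space P) = ennreal lam * ennreal (w i)"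
    and j0: "j0 \<in> P" "conv_radius (\<lambda>n. matrix_power P M n j0 j0) = ereal (1 / lam)"
    by (rule recurrent_eigenvector[OF P(2)]) blast
  interpret weighted_markov_map T P w lam
    using w by unfold_locales
  show ?thesis
    by (rule linearizable_of_htop) (rule htop_ge_conv_radius[OF j0(1) lam_pos j0(2)])
qed

end
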